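(* Let $\tau=q^{1/2}$ and let $\Theta$ be an invertible element of the center $Z(T)$ of $T$. Then $\mathbb{C}P$ becomes a $U_\tau(\mathfrak{sl}_2)$-module on which the generators act as follows: $e$ acts as $\Theta L$, $f$ acts as $q^{-N-M+\frac12}\Theta^{-1}\Phi\Omega R$, and $k$ acts as $q^{-N-M}\Phi\Omega K$.
   Context: Let $N,M$ be positive integers, let $\mathbb{F}_q$ be a finite field with $q$ elements, and fix a square root $q^{1/2}$ (and write $q^{s/2}=(q^{1/2})^s$). Let $H$ be an $(N+M)$-dimensional vector space over $\mathbb{F}_q$ and fix an $M$-dimensional subspace $h$ of $H$. Let $P$ be the set of subspaces $x$ of $H$ with $x\cap h=0$, partially ordered by inclusion (the attenuated space poset $\mathcal{A}_q(N,M)$), and for $0\le i\le N$ let $P_i$ be the set of elements of $P$ of dimension $i$. For $x,y\in P$ say $y$ covers $x$ if $x\subsetneq y$ and there is no $z\in P$ with $x\subsetneq z\subsetneq y$. Let $\mathrm{Mat}_P(\mathbb{C})$ be the algebra of complex matrices with rows and columns indexed by $P$. Define $L,R\in\mathrm{Mat}_P(\mathbb{C})$ by $L_{xy}=1$ if $y$ covers $x$ and $0$ otherwise, and $R_{xy}=1$ if $x$ covers $y$ and $0$ otherwise. For $0\le i\le N$ let $F_i$ be the diagonal matrix with $(F_i)_{yy}=1$ if $y\in P_i$ and $0$ otherwise. Let $K=\sum_{i=0}^N q^{N+M-i}F_i$. Let $T$ be the subalgebra of $\mathrm{Mat}_P(\mathbb{C})$ generated by $R,L,K,K^{-1}$,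 and let $\mathbb{C}P$ be the complex vector space with basis $P$, viewed as a $T$-module. A $T$-module means a $T$-submodule of $\mathbb{C}P$. For an irreducible $T$-module $W$, its endpoint is $\min\{i: 0\le i\le N,\ F_iW\neq 0\}$ and its diameter is $|\{i:0\le i\le N,\ F_iW\ne0\}|-1$. Let $\Psi$ be the set of pairs $(r,d)$ that occur as (endpoint, diameter) of an irreducible $T$-module. For $\lambda=(r,d)\in\Psi$ let $V_\lambda$ be the span of all irreducible $T$-modules with endpoint $r$ and diameter $d$; then $\mathbb{C}P=\bigoplus_{\lambda\in\Psi}V_\lambda$, and $e_\lambda$ denotes the linear map acting as the identity on $V_\lambda$ and as $0$ on $V_\mu$ for $\mu\neq\lambda$; the $e_\lambda$ ($\lambda\in\Psi$) lie in $T$ and form a basis of $Z(T)$. Define $\Phi=\sum_{(r,d)\in\Psi}q^r e_{(r,d)}$ and $\Omega=\sum_{(r,d)\in\Psi}q^{d/2}e_{(r,d)}$. For nonzero $\tau\in\mathbb{C}$ not a root of unity, $U_\tau(\mathfrak{sl}_2)$ is the $\mathbb{C}$-algebra with generators $e,f,k^{\pm1}$ and relations $kk^{-1}=k^{-1}k=1$, $ke=\tau^2ek$, $kf=\tau^{-2}fk$, $ef-fe=\frac{k-k^{-1}}{\tau-\tau^{-1}}$. *)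

theory Defs
  imports Complex_Main "HOL-Library.Cardinality" "HOL-Library.Function_Algebras"
    "HOL-Library.Poly_Mapping" "HOL-Algebra.QuotRing"
begin

section \<open>Complex matrices and column vectors indexed by a set\<close>

text \<open>
  An element of \<open>Mat\<^sub>P(\<complex>)\<close> is a function of two indices vanishing outside \<open>P \<times> P\<close>; an element of
  \<open>\<complex>P\<close> is a function of one index vanishing outside \<open>P\<close>, the basis vector \<open>x \<in> P\<close> being the
  indicator of \<open>x\<close>. Addition and finite sums are the pointwise ones. The pointwise product of
  \<open>Function_Algebras\<close> is never used.
\<close>

definition vec_scale :: "complex \<Rightarrow> ('p \<Rightarrow> complex) \<Rightarrow> 'p \<Rightarrow> complex" where
  "vec_scale c v = (\<lambda>x. c * v x)"

definition mat_scale :: "complex \<Rightarrow> ('p \<Rightarrow> 'p \<Rightarrow> complex) \<Rightarrow> 'p \<Rightarrow> 'p \<Rightarrow> complex" where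
  "mat_scale c A = (\<lambda>x y. c * A x y)"

definition vecs :: "'p set \<Rightarrow> ('p \<Rightarrow> complex) set" where
  "vecs P = {v. \<forall>x. x \<notin> P \<longrightarrow> v x = 0}"

definition mats :: "'p set \<Rightarrow> ('p \<Rightarrow> 'p \<Rightarrow> complex) set" where
  "mats P = {A. \<forall>x y. x \<notin> P \<or> y \<notin> P \<longrightarrow> A x y = 0}"

definition mat_mult ::
    "'p set \<Rightarrow> ('p \<Rightarrow> 'p \<Rightarrow> complex) \<Rightarrow> ('p \<Rightarrow> 'p \<Rightarrow> complex) \<Rightarrow> 'p \<Rightarrow> 'p \<Rightarrow> complex" where
  "mat_mult P A B = (\<lambda>x y. \<Sum>z\<in>P. A x z * B z y)"

definition mat_vec :: "'p set \<Rightarrow> ('p \<Rightarrow> 'p \<Rightarrow> complex) \<Rightarrow> ('p \<Rightarrow> complex) \<Rightarrow> 'p \<Rightarrow> complex" where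
  "mat_vec P A v = (\<lambda>x. \<Sum>y\<in>P. A x y * v y)"

definition mat_one :: "'p set \<Rightarrow> 'p \<Rightarrow> 'p \<Rightarrow> complex" where
  "mat_one P = (\<lambda>x y. if x = y \<and> x \<in> P then 1 else 0)"

definition mat_inv :: "'p set \<Rightarrow> ('p \<Rightarrow> 'p \<Rightarrow> complex) \<Rightarrow> 'p \<Rightarrow> 'p \<Rightarrow> complex" where
  "mat_inv P A =
    (THE B. B \<in> mats P \<and> mat_mult P A B = mat_one P \<and> mat_mult P B A = mat_one P)"

definition mat_subalgebra :: "'p set \<Rightarrow> ('p \<Rightarrow> 'p \<Rightarrow> complex) set \<Rightarrow> bool" where
  "mat_subalgebra P S \<longleftrightarrow>
    S \<subseteq> mats P \<and> mat_one P \<in> S \<and>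
    (\<forall>A\<in>S. \<forall>B\<in>S. A + B \<in> S \<and> mat_mult P A B \<in> S) \<and>
    (\<forall>c. \<forall>A\<in>S. mat_scale c A \<in> S)"

definition mat_center :: "'p set \<Rightarrow> ('p \<Rightarrow> 'p \<Rightarrow> complex) set \<Rightarrow> ('p \<Rightarrow> 'p \<Rightarrow> complex) set" where
  "mat_center P T = {Z \<in> T. \<forall>A\<in>T. mat_mult P Z A = mat_mult P A Z}"

definition submodule_of ::
    "'p set \<Rightarrow> ('p \<Rightarrow> 'p \<Rightarrow> complex) set \<Rightarrow> ('p \<Rightarrow> complex) set \<Rightarrow> bool" where
  "submodule_of P T W \<longleftrightarrow>
    W \<subseteq> vecs P \<and> module.subspace vec_scale W \<and> (\<forall>A\<in>T. \<forall>w\<in>W. mat_vec P A w \<in> W)"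

definition irreducible_submodule_of ::
    "'p set \<Rightarrow> ('p \<Rightarrow> 'p \<Rightarrow> complex) set \<Rightarrow> ('p \<Rightarrow> complex) set \<Rightarrow> bool" where
  "irreducible_submodule_of P T W \<longleftrightarrow>
    submodule_of P T W \<and> W \<noteq> {0} \<and>
    (\<forall>W'. submodule_of P T W' \<and> W' \<subseteq> W \<longrightarrow> W' = {0} \<or> W' = W)"


section \<open>The attenuated space poset\<close>

text \<open>
  \<open>H\<close> is the whole type \<open>'b\<close>, a vector space over the finite field \<open>'a\<close> with scalar
  multiplication \<open>scale\<close>, so that \<open>q = CARD('a)\<close>.
\<close>

definition att_poset ::
    "('a::field \<Rightarrow> 'b::ab_group_add \<Rightarrow> 'b) \<Rightarrow> 'b set \<Rightarrow> 'b set set" where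
  "att_poset scale h = {x. module.subspace scale x \<and> x \<inter> h = {0}}"

definition att_level ::
    "('a::field \<Rightarrow> 'b::ab_group_add \<Rightarrow> 'b) \<Rightarrow> 'b set \<Rightarrow> nat \<Rightarrow> 'b set set" where
  "att_level scale h i = {x \<in> att_poset scale h. vector_space.dim scale x = i}"

definition covered_by :: "'b set set \<Rightarrow> 'b set \<Rightarrow> 'b set \<Rightarrow> bool" where
  "covered_by P x y \<longleftrightarrow> x \<in> P \<and> y \<in> P \<and> x \<subset> y \<and> \<not> (\<exists>z\<in>P. x \<subset> z \<and> z \<subset> y)"

definition lowering :: "'b set set \<Rightarrow> 'b set \<Rightarrow> 'b set \<Rightarrow> complex" where
  "lowering P = (\<lambda>x y. if covered_by P x y then 1 else 0)"

definition raising :: "'b set set \<Rightarrow> 'b set \<Rightarrow> 'b set \<Rightarrow> complex" where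
  "raising P = (\<lambda>x y. if covered_by P y x then 1 else 0)"

definition att_F ::
    "('a::field \<Rightarrow> 'b::ab_group_add \<Rightarrow> 'b) \<Rightarrow> 'b set \<Rightarrow> nat \<Rightarrow> 'b set \<Rightarrow> 'b set \<Rightarrow> complex" where
  "att_F scale h i = (\<lambda>x y. if x = y \<and> y \<in> att_level scale h i then 1 else 0)"

definition att_K ::
    "('a::{field,finite} \<Rightarrow> 'b::ab_group_add \<Rightarrow> 'b) \<Rightarrow> 'b set \<Rightarrow> nat \<Rightarrow> nat
      \<Rightarrow> 'b set \<Rightarrow> 'b set \<Rightarrow> complex" where
  "att_K scale h N M =
    (\<Sum>i=0..N. mat_scale (of_nat CARD('a) ^ (N + M - i)) (att_F scale h i))"

definition att_T ::
    "('a::{field,finite} \<Rightarrow> 'b::ab_group_add \<Rightarrow> 'b) \<Rightarrow> 'b set \<Rightarrow> nat \<Rightarrow> nat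
      \<Rightarrow> ('b set \<Rightarrow> 'b set \<Rightarrow> complex) set" where
  "att_T scale h N M =
    mat_subalgebra (att_poset scale h) hull
      {raising (att_poset scale h), lowering (att_poset scale h),
       att_K scale h N M, mat_inv (att_poset scale h) (att_K scale h N M)}"

definition att_support ::
    "('a::field \<Rightarrow> 'b::ab_group_add \<Rightarrow> 'b) \<Rightarrow> 'b set \<Rightarrow> nat \<Rightarrow> ('b set \<Rightarrow> complex) set \<Rightarrow> nat set" where
  "att_support scale h N W =
    {i \<in> {0..N}. mat_vec (att_poset scale h) (att_F scale h i) ` W \<noteq> {0}}"

definition endpoint ::
    "('a::field \<Rightarrow> 'b::ab_group_add \<Rightarrow> 'b) \<Rightarrow> 'b set \<Rightarrow> nat \<Rightarrow> ('b set \<Rightarrow> complex) set \<Rightarrow> nat" where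
  "endpoint scale h N W = Min (att_support scale h N W)"

definition diameter ::
    "('a::field \<Rightarrow> 'b::ab_group_add \<Rightarrow> 'b) \<Rightarrow> 'b set \<Rightarrow> nat \<Rightarrow> ('b set \<Rightarrow> complex) set \<Rightarrow> nat" where
  "diameter scale h N W = card (att_support scale h N W) - 1"

definition irreducibles_of_type ::
    "('a::{field,finite} \<Rightarrow> 'b::ab_group_add \<Rightarrow> 'b) \<Rightarrow> 'b set \<Rightarrow> nat \<Rightarrow> nat \<Rightarrow> nat \<times> nat
      \<Rightarrow> ('b set \<Rightarrow> complex) set set" where
  "irreducibles_of_type scale h N M l =
    {W. irreducible_submodule_of (att_poset scale h) (att_T scale h N M) W \<and>
        (endpoint scale h N W, diameter scale h N W) = l}"

definition att_Psi ::
    "('a::{field,finite} \<Rightarrow> 'b::ab_group_add \<Rightarrow> 'b) \<Rightarrow> 'b set \<Rightarrow> nat \<Rightarrow> nat \<Rightarrow> (nat \<times> nat) set" where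
  "att_Psi scale h N M = {l. irreducibles_of_type scale h N M l \<noteq> {}}"

definition att_V ::
    "('a::{field,finite} \<Rightarrow> 'b::ab_group_add \<Rightarrow> 'b) \<Rightarrow> 'b set \<Rightarrow> nat \<Rightarrow> nat \<Rightarrow> nat \<times> nat
      \<Rightarrow> ('b set \<Rightarrow> complex) set" where
  "att_V scale h N M l = module.span vec_scale (\<Union> (irreducibles_of_type scale h N M l))"

definition att_e ::
    "('a::{field,finite} \<Rightarrow> 'b::ab_group_add \<Rightarrow> 'b) \<Rightarrow> 'b set \<Rightarrow> nat \<Rightarrow> nat \<Rightarrow> nat \<times> nat
      \<Rightarrow> 'b set \<Rightarrow> 'b set \<Rightarrow> complex" where
  "att_e scale h N M l =
    (THE E. E \<in> mats (att_poset scale h) \<and>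
      (\<forall>v\<in>att_V scale h N M l. mat_vec (att_poset scale h) E v = v) \<and>
      (\<forall>m\<in>att_Psi scale h N M. m \<noteq> l \<longrightarrow>
        (\<forall>v\<in>att_V scale h N M m. mat_vec (att_poset scale h) E v = 0)))"

definition att_Phi ::
    "('a::{field,finite} \<Rightarrow> 'b::ab_group_add \<Rightarrow> 'b) \<Rightarrow> 'b set \<Rightarrow> nat \<Rightarrow> nat
      \<Rightarrow> 'b set \<Rightarrow> 'b set \<Rightarrow> complex" where
  "att_Phi scale h N M =
    (\<Sum>(r, d)\<in>att_Psi scale h N M. mat_scale (of_nat CARD('a) ^ r) (att_e scale h N M (r, d)))"

text \<open>The argument \<open>s\<close> is the chosen square root \<open>q\<^sup>1\<^sup>/\<^sup>2\<close>, so \<open>q\<^sup>d\<^sup>/\<^sup>2 = s ^ d\<close>.\<close>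

definition att_Omega ::
    "('a::{field,finite} \<Rightarrow> 'b::ab_group_add \<Rightarrow> 'b) \<Rightarrow> 'b set \<Rightarrow> nat \<Rightarrow> nat \<Rightarrow> complex
      \<Rightarrow> 'b set \<Rightarrow> 'b set \<Rightarrow> complex" where
  "att_Omega scale h N M s =
    (\<Sum>(r, d)\<in>att_Psi scale h N M. mat_scale (s ^ d) (att_e scale h N M (r, d)))"


section \<open>The quantum algebra \<open>U\<^sub>\<tau>(sl\<^sub>2)\<close> and its modules\<close>

text \<open>
  The free algebra \<open>\<complex>\<langle>e, f, k, k\<inverse>\<rangle>\<close> is the monoid algebra of the free monoid of words: finitely
  supported functions on words, whose product is convolution.
\<close>

datatype 'g free_word = Word (letters: "'g list")

instantiation free_word :: (type) monoid_add
begin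

definition zero_free_word :: "'a free_word" where
  "zero_free_word = Word []"

definition plus_free_word :: "'a free_word \<Rightarrow> 'a free_word \<Rightarrow> 'a free_word" where
  "plus_free_word u v = Word (letters u @ letters v)"

instance
  by standard (simp_all add: zero_free_word_def plus_free_word_def)

end

datatype usl2_gen = Gen_e | Gen_f | Gen_k | Gen_kinv

type_synonym usl2_free = "usl2_gen free_word \<Rightarrow>\<^sub>0 complex"

definition free_ring :: "usl2_free ring" where
  "free_ring = \<lparr>carrier = UNIV, mult = (*), one = 1, zero = 0, add = (+)\<rparr>"

definition free_gen :: "usl2_gen \<Rightarrow> usl2_free" where
  "free_gen g = Poly_Mapping.single (Word [g]) 1"

definition free_const :: "complex \<Rightarrow> usl2_free" where
  "free_const c = Poly_Mapping.single 0 c"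

definition usl2_relators :: "complex \<Rightarrow> usl2_free set" where
  "usl2_relators \<tau> =
    (let e = free_gen Gen_e; f = free_gen Gen_f; k = free_gen Gen_k; k' = free_gen Gen_kinv in
      {k * k' - 1, k' * k - 1,
       k * e - free_const (\<tau> powi 2) * e * k,
       k * f - free_const (\<tau> powi (-2)) * f * k,
       (e * f - f * e) - free_const (inverse (\<tau> - inverse \<tau>)) * (k - k')})"

definition usl2_ideal :: "complex \<Rightarrow> usl2_free set" where
  "usl2_ideal \<tau> = Idl\<^bsub>free_ring\<^esub> (usl2_relators \<tau>)"

definition usl2 :: "complex \<Rightarrow> usl2_free set ring" where
  "usl2 \<tau> = free_ring Quot usl2_ideal \<tau>"

definition usl2_class :: "complex \<Rightarrow> usl2_free \<Rightarrow> usl2_free set" where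
  "usl2_class \<tau> a = usl2_ideal \<tau> +>\<^bsub>free_ring\<^esub> a"

definition usl2_gen_class :: "complex \<Rightarrow> usl2_gen \<Rightarrow> usl2_free set" where
  "usl2_gen_class \<tau> g = usl2_class \<tau> (free_gen g)"

text \<open>
  A left module structure over the \<open>\<complex>\<close>-algebra \<open>U\<^sub>\<tau>(sl\<^sub>2)\<close> on a complex vector space \<open>V\<close>; the last
  condition says that the scalars \<open>\<complex> \<cdot> 1\<close> of the algebra act by the given scalar multiplication
  of \<open>V\<close>.
\<close>

definition usl2_module ::
    "complex \<Rightarrow> ('p \<Rightarrow> complex) set \<Rightarrow> (usl2_free set \<Rightarrow> ('p \<Rightarrow> complex) \<Rightarrow> 'p \<Rightarrow> complex) \<Rightarrow> bool" where
  "usl2_module \<tau> V act \<longleftrightarrow>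
    module.subspace vec_scale V \<and>
    (\<forall>a\<in>carrier (usl2 \<tau>). \<forall>v\<in>V. act a v \<in> V) \<and>
    (\<forall>a\<in>carrier (usl2 \<tau>). \<forall>v\<in>V. \<forall>w\<in>V. act a (v + w) = act a v + act a w) \<and>
    (\<forall>a\<in>carrier (usl2 \<tau>). \<forall>b\<in>carrier (usl2 \<tau>). \<forall>v\<in>V.
      act (a \<oplus>\<^bsub>usl2 \<tau>\<^esub> b) v = act a v + act b v) \<and>
    (\<forall>a\<in>carrier (usl2 \<tau>). \<forall>b\<in>carrier (usl2 \<tau>). \<forall>v\<in>V.
      act (a \<otimes>\<^bsub>usl2 \<tau>\<^esub> b) v = act a (act b v)) \<and>
    (\<forall>v\<in>V. act \<one>\<^bsub>usl2 \<tau>\<^esub> v = v) \<and>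
    (\<forall>c. \<forall>v\<in>V. act (usl2_class \<tau> (free_const c)) v = vec_scale c v)"

end

theory Submission
  imports Defs
begin

text \<open>
  With \<open>q = CARD('a)\<close> and \<open>n = N + M\<close>, counting walks of length three in the Hasse diagram gives the
  cubic relation \<open>(q + 1) L R L = q R L\<^sup>2 + L\<^sup>2 R + (q + 1) L K\<close>. It says precisely that
  \<open>Z = (q + 1) K - (q - 1) (L R - q R L)\<close> commutes with \<open>L\<close>, and transposing, with \<open>R\<close>.
  An irreducible module of endpoint \<open>r\<close> and diameter \<open>d\<close> is spanned by a string
  \<open>v, R v, \<dots>, R\<^sup>d v\<close> on which \<open>Z\<close> acts as the scalar \<open>q\<^sup>n\<^sup>-\<^sup>r\<^sup>+\<^sup>1 + q\<^sup>n\<^sup>-\<^sup>r\<^sup>-\<^sup>d\<close>. These scalars determine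
  \<open>(r, d)\<close>, so Lagrange interpolation in \<open>Z\<close> produces the idempotents \<open>e\<^sub>\<lambda>\<close>; complete
  reducibility (\<open>R\<close> and \<open>L\<close> are adjoint) makes them unique. The relations of the quantum algebra then
  only have to be checked on strings, where \<open>L\<close> and \<open>R\<close> have explicit coefficients, the central
  factor \<open>\<Theta>\<close> cancelling between \<open>e\<close> and \<open>f\<close>.
\<close>

text \<open>The constants of the theorem turn each string into the standard module of dimension d +
  1. On \<open>R^i v\<close> the operator \<open>K\<close> is q^(n-r-i), so q^-n Phi Omega K acts as
  q^-n q^r \<tau>^d q^(n-r-i) = \<tau>^(d-2i), the usual weight; the scalar in front of
  \<open>R\<close> turns the difference of consecutive lowering coefficients into the quantum
  integer [d-2i].

  Two obstacles shape the proof. The projections onto the V_\<lambda> are given by definite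
  descriptions, so nothing can be said about Phi and Omega before such projections are known to
  exist and to be unique; this is why the irreducible modules are analysed and shown to span
  everything before the quantum algebra is mentioned. And the quantum algebra is a quotient of a
  free algebra by a generated ideal, so a module structure must be defined on cosets, starting from
  operators for the four generators.\<close>

global_interpretation vec: vector_space vec_scale
  by unfold_locales (auto simp: vec_scale_def fun_eq_iff algebra_simps)

section \<open>Modules over the quantum algebra from operators\<close>

text \<open>\<open>foldr\<close> lets the last letter of a word act first, so concatenation of words
  becomes composition of operators, as \<open>free_act_mult\<close> needs.\<close>

definition free_act ::
    "(usl2_gen \<Rightarrow> ('p \<Rightarrow> complex) \<Rightarrow> 'p \<Rightarrow> complex) \<Rightarrow> usl2_free \<Rightarrow> ('p \<Rightarrow> complex) \<Rightarrow> 'p \<Rightarrow> complex" where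
  "free_act \<rho> a v =
    (\<Sum>w\<in>Poly_Mapping.keys a. vec_scale (Poly_Mapping.lookup a w) (foldr \<rho> (letters w) v))"

text \<open>Two elements and their sum have different supports; over a common finite superset
  additivity can be checked term by term.\<close>

lemma free_act_superset:
  assumes "finite S" "Poly_Mapping.keys a \<subseteq> S"
  shows "free_act \<rho> a v = (\<Sum>w\<in>S. vec_scale (Poly_Mapping.lookup a w) (foldr \<rho> (letters w) v))"
  unfolding free_act_def
  using assms by (intro sum.mono_neutral_left) (auto simp: in_keys_iff)

lemma free_act_zero [simp]: "free_act \<rho> 0 v = 0"
  by (simp add: free_act_def)

lemma free_act_add: "free_act \<rho> (a + b) v = free_act \<rho> a v + free_act \<rho> b v"
proof -
  let ?S = "Poly_Mapping.keys a \<union> Poly_Mapping.keys b"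
  have "free_act \<rho> c v = (\<Sum>w\<in>?S. vec_scale (Poly_Mapping.lookup c w) (foldr \<rho> (letters w) v))"
    if "c \<in> {a, b, a + b}" for c
    using that Poly_Mapping.keys_add[of a b] by (intro free_act_superset) auto
  then show ?thesis
    by (simp add: lookup_add vec.scale_left_distrib sum.distrib)
qed

lemma free_act_diff: "free_act \<rho> (a - b) v = free_act \<rho> a v - free_act \<rho> b v"
  using free_act_add[of \<rho> "a - b" b v] by simp

lemma free_act_single: "free_act \<rho> (Poly_Mapping.single w c) v = vec_scale c (foldr \<rho> (letters w) v)"
  by (subst free_act_superset[of "{w}"]) auto

lemma free_act_one: "free_act \<rho> 1 v = v"
  using free_act_single[of \<rho> 0 1 v] by (simp add: zero_free_word_def[symmetric]) (simp add: zero_free_word_def)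

lemma free_act_gen: "free_act \<rho> (free_gen g) v = \<rho> g v"
  by (simp add: free_gen_def free_act_single)

lemma free_act_const: "free_act \<rho> (free_const c) v = vec_scale c v"
  by (simp add: free_const_def free_act_single zero_free_word_def)

text \<open>Additive statements only have to be checked on monomials. Multiplicativity of the action
  uses this twice, once for each factor.\<close>

lemma poly_mapping_monomial_induct [case_names zero add]:
  assumes "P 0" and "\<And>a w c. P a \<Longrightarrow> P (a + Poly_Mapping.single w c)"
  shows "P (a :: 'k \<Rightarrow>\<^sub>0 'v::comm_monoid_add)"
proof (induction a rule: update_induct)
  case const
  then show ?case using assms(1) by simp
next
  case (update f k v)
  have "Poly_Mapping.update k v f = f + Poly_Mapping.single k v"
    using update(1)
    by (intro poly_mapping_eqI)
      (auto simp: lookup_update lookup_add lookup_single when_def in_keys_iff)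
  then show ?case using assms(2)[OF update(3)] by simp
qed

locale linear_generators =
  fixes \<rho> :: "usl2_gen \<Rightarrow> ('p \<Rightarrow> complex) \<Rightarrow> 'p \<Rightarrow> complex"
  assumes gen_add: "\<rho> g (v + w) = \<rho> g v + \<rho> g w"
    and gen_scale: "\<rho> g (vec_scale c v) = vec_scale c (\<rho> g v)"
begin

lemma word_add: "foldr \<rho> ws (v + w) = foldr \<rho> ws v + foldr \<rho> ws w"
  by (induction ws) (simp_all only: foldr.simps id_apply o_apply gen_add)

lemma word_scale: "foldr \<rho> ws (vec_scale c v) = vec_scale c (foldr \<rho> ws v)"
  by (induction ws) (simp_all only: foldr.simps id_apply o_apply gen_scale)

lemma free_act_vec_add: "free_act \<rho> a (v + w) = free_act \<rho> a v + free_act \<rho> a w"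
  by (simp add: free_act_def word_add vec.scale_right_distrib sum.distrib)

lemma free_act_vec_zero: "free_act \<rho> a 0 = 0"
  using free_act_vec_add[of a 0 0] by simp

lemma free_act_single_mult:
  "free_act \<rho> (Poly_Mapping.single u c * b) v = free_act \<rho> (Poly_Mapping.single u c) (free_act \<rho> b v)"
proof (induction b rule: poly_mapping_monomial_induct)
  case zero
  show ?case by (simp only: mult_zero_right free_act_zero free_act_vec_zero)
next
  case (add b w d)
  then show ?case
    by (simp only: distrib_left free_act_add free_act_vec_add mult_single free_act_single
        word_add word_scale plus_free_word_def vec.scale_right_distrib vec.scale_scale
        free_word.sel foldr_append o_apply)
qed

lemma free_act_mult: "free_act \<rho> (a * b) v = free_act \<rho> a (free_act \<rho> b v)"
  by (induction a rule: poly_mapping_monomial_induct)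
    (simp_all add: distrib_right free_act_add free_act_single_mult)

lemma free_act_closed:
  assumes "vec.subspace V" "\<And>g v. v \<in> V \<Longrightarrow> \<rho> g v \<in> V" "v \<in> V"
  shows "free_act \<rho> a v \<in> V"
proof -
  have "foldr \<rho> ws v \<in> V" for ws
    using assms by (induction ws) auto
  then show ?thesis
    using assms(1) by (auto simp: free_act_def intro!: vec.subspace_sum vec.subspace_scale)
qed

end

section \<open>The free algebra, its quotient, and modules over the quotient\<close>

lemma free_ring_simps [simp]:
  "carrier free_ring = UNIV" "mult free_ring = (*)" "one free_ring = 1"
  "zero free_ring = 0" "add free_ring = (+)"
  by (simp_all add: free_ring_def)

lemma ring_free_ring: "ring free_ring"
proof (rule ringI)
  show "abelian_group free_ring"
  proof (rule abelian_groupI; simp add: add.commute add.left_commute)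
    show "\<exists>y. x + y = 0" for x :: usl2_free
      by (rule exI[of _ "- x"]) simp
  qed
  show "monoid free_ring"
    by unfold_locales (simp_all add: mult.assoc)
qed (simp_all add: algebra_simps)

lemma ideal_usl2_ideal: "ideal (usl2_ideal \<tau>) free_ring"
  unfolding usl2_ideal_def using ring_free_ring by (intro ring.genideal_ideal) simp_all

lemma usl2_class_mem: "b \<in> usl2_class \<tau> a \<longleftrightarrow> b - a \<in> usl2_ideal \<tau>"
  by (auto simp: usl2_class_def a_r_coset_def' Bex_def eq_diff_eq[symmetric])

lemma usl2_carrierE:
  assumes "A \<in> carrier (usl2 \<tau>)"
  obtains a where "A = usl2_class \<tau> a"
  using assms by (auto simp: usl2_def FactRing_def A_RCOSETS_def' usl2_class_def)

lemma usl2_ops: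
  shows "usl2_class \<tau> a \<oplus>\<^bsub>usl2 \<tau>\<^esub> usl2_class \<tau> b = usl2_class \<tau> (a + b)"
    and "usl2_class \<tau> a \<otimes>\<^bsub>usl2 \<tau>\<^esub> usl2_class \<tau> b = usl2_class \<tau> (a * b)"
    and "\<one>\<^bsub>usl2 \<tau>\<^esub> = usl2_class \<tau> 1"
proof -
  interpret ideal "usl2_ideal \<tau>" free_ring
    by (rule ideal_usl2_ideal)
  have hom: "usl2_class \<tau> \<in> ring_hom free_ring (usl2 \<tau>)"
    using rcos_ring_hom by (simp add: usl2_def usl2_class_def[abs_def])
  show "usl2_class \<tau> a \<oplus>\<^bsub>usl2 \<tau>\<^esub> usl2_class \<tau> b = usl2_class \<tau> (a + b)"
    using ring_hom_add[OF hom, of a b] by simp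
  show "usl2_class \<tau> a \<otimes>\<^bsub>usl2 \<tau>\<^esub> usl2_class \<tau> b = usl2_class \<tau> (a * b)"
    using ring_hom_mult[OF hom, of a b] by simp
  show "\<one>\<^bsub>usl2 \<tau>\<^esub> = usl2_class \<tau> 1"
    using ring_hom_one[OF hom] by simp
qed

text \<open>The elements of the free algebra that kill \<open>V\<close> form a two-sided ideal;
  right multiples stay in it because the generators preserve \<open>V\<close>. The five hypotheses
  put the relators into this ideal, hence also the ideal they generate, and the action descends to
  the quotient.\<close>

lemma (in linear_generators) usl2_moduleI:
  assumes V: "vec.subspace V" "\<And>g v. v \<in> V \<Longrightarrow> \<rho> g v \<in> V"
    and kk': "\<And>v. v \<in> V \<Longrightarrow> \<rho> Gen_k (\<rho> Gen_kinv v) = v"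
    and k'k: "\<And>v. v \<in> V \<Longrightarrow> \<rho> Gen_kinv (\<rho> Gen_k v) = v"
    and ke: "\<And>v. v \<in> V \<Longrightarrow> \<rho> Gen_k (\<rho> Gen_e v) = vec_scale (\<tau> powi 2) (\<rho> Gen_e (\<rho> Gen_k v))"
    and kf: "\<And>v. v \<in> V \<Longrightarrow> \<rho> Gen_k (\<rho> Gen_f v) = vec_scale (\<tau> powi -2) (\<rho> Gen_f (\<rho> Gen_k v))"
    and ef: "\<And>v. v \<in> V \<Longrightarrow> \<rho> Gen_e (\<rho> Gen_f v) - \<rho> Gen_f (\<rho> Gen_e v) =
      vec_scale (inverse (\<tau> - inverse \<tau>)) (\<rho> Gen_k v - \<rho> Gen_kinv v)"
  shows "\<exists>act. usl2_module \<tau> V act \<and> (\<forall>g. \<forall>v\<in>V. act (usl2_gen_class \<tau> g) v = \<rho> g v)"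
proof -
  define I where "I = {a. \<forall>v\<in>V. free_act \<rho> a v = 0}"
  note closed = free_act_closed[OF V]
  interpret ring free_ring by (rule ring_free_ring)
  have "ideal I free_ring"
  proof (rule idealI[OF ring_free_ring])
    show "subgroup I (add_monoid free_ring)"
    proof (rule group.subgroupI[OF add.is_group])
      show "inv\<^bsub>add_monoid free_ring\<^esub> a \<in> I" if "a \<in> I" for a
      proof -
        have "inv\<^bsub>add_monoid free_ring\<^esub> a = - a"
          using add.inv_equality[of "- a" a] by (simp add: a_inv_def)
        then show ?thesis
          using that free_act_diff[of \<rho> 0 a] by (simp add: I_def)
      qed
      show "I \<noteq> {}" using free_act_zero unfolding I_def by blast
    qed (auto simp: I_def free_act_add)
  qed (auto simp: I_def free_act_mult free_act_vec_zero closed)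
  moreover have "usl2_relators \<tau> \<subseteq> I"
    using assms by (auto simp: usl2_relators_def Let_def I_def free_act_diff free_act_mult
        free_act_gen free_act_const free_act_one)
  ultimately have I: "usl2_ideal \<tau> \<subseteq> I"
    unfolding usl2_ideal_def by (rule genideal_minimal)
  \<comment> \<open>A coset acts through an arbitrary representative; on \<open>V\<close> the choice
    does not matter, as representatives differ by an element of \<open>I\<close>.\<close>
  define act where "act A = free_act \<rho> (SOME a. a \<in> A)" for A
  have act: "act (usl2_class \<tau> a) v = free_act \<rho> a v" if "v \<in> V" for a v
  proof -
    have "0 \<in> usl2_ideal \<tau>"
      using additive_subgroup.zero_closed[OF ideal.axioms(1)[OF ideal_usl2_ideal]] by simp
    then have "a \<in> usl2_class \<tau> a"
      by (simp add: usl2_class_mem)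
    then have "(SOME b. b \<in> usl2_class \<tau> a) - a \<in> I"
      using I someI[of "\<lambda>b. b \<in> usl2_class \<tau> a" a] by (auto simp: usl2_class_mem)
    then show ?thesis
      using that by (simp add: I_def act_def free_act_diff)
  qed
  have "usl2_module \<tau> V act"
    unfolding usl2_module_def
    using V(1) closed
    by (auto simp: act usl2_ops free_act_vec_add free_act_add free_act_mult free_act_one
        free_act_const vec.subspace_add elim!: usl2_carrierE)
  then show ?thesis
    using act by (auto simp: usl2_gen_class_def free_act_gen)
qed

section \<open>Counting in the attenuated space poset\<close>

locale attenuated_space = vector_space scale
  for scale :: "'a::{field,finite} \<Rightarrow> 'b::ab_group_add \<Rightarrow> 'b" +
  fixes h :: "'b set" and N M :: nat
  assumes N_pos: "N > 0" and M_pos: "M > 0"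
    and dim_whole: "dim UNIV = N + M"
    and subspace_h: "subspace h" and dim_h: "dim h = M"
begin

section \<open>Finite dimension and cardinalities of subspaces\<close>

definition bas :: "'b set" where
  "bas = (SOME B. finite B \<and> independent B \<and> span B = UNIV)"

lemma bas: "finite bas" "independent bas" "span bas = UNIV"
proof -
  obtain B where "independent B" "UNIV \<subseteq> span B"
    using maximal_independent_subset[of UNIV] by blast
  then have B: "independent B" "span B = UNIV"
    by auto
  then have "card B = N + M"
    using dim_span_eq_card_independent[OF B(1)] dim_whole by simp
  \<comment> \<open>\<open>card\<close> is 0 on infinite sets, so a basis of positive cardinality is
    finite.\<close>
  then have "finite B"
    using N_pos by (intro card_ge_0_finite) simp
  then have "\<exists>B. finite B \<and> independent B \<and> span B = UNIV"
    using B by blast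
  then have "finite bas \<and> independent bas \<and> span bas = UNIV"
    unfolding bas_def by (rule someI_ex)
  then show "finite bas" "independent bas" "span bas = UNIV" by auto
qed

sublocale finite_dimensional_vector_space scale bas
  using bas by unfold_locales

lemma card_bas: "card bas = N + M"
  using dim_UNIV dim_whole by simp

lemma q_ge_2: "2 \<le> CARD('a)"
proof -
  have "card {0, 1 :: 'a} \<le> CARD('a)" by (rule card_mono) auto
  then show ?thesis by simp
qed

lemma span_insert_image:
  assumes "subspace x"
  shows "span (insert v x) = (\<lambda>(k, u). u + scale k v) ` (UNIV \<times> x)"
proof -
  have x: "span x = x" using assms by simp
  have "u \<in> (\<lambda>(k, u). u + scale k v) ` (UNIV \<times> x)" if "u - scale k v \<in> x" for u k
    using that by (intro image_eqI[of _ _ "(k, u - scale k v)"]) auto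
  moreover have "\<exists>k. u + scale l v - scale k v \<in> x" if "u \<in> x" for u l
    using that by (intro exI[of _ l]) simp
  ultimately show ?thesis
    unfolding span_insert x by auto
qed

lemma span_insert_span: "span (insert a B) = span (insert a (span B))"
  unfolding span_insert by (simp only: span_span)

lemma finite_span: "finite B \<Longrightarrow> finite (span B)"
proof (induction B rule: finite_induct)
  case (insert a B)
  then show ?case
    using insert by (subst span_insert_span) (simp add: span_insert_image)
qed simp

lemma finite_UNIV [simp]: "finite (UNIV :: 'b set)"
  using finite_span[OF bas(1)] bas(3) by simp

lemma finite_vectors [simp]: "finite (x :: 'b set)"
  by (rule finite_subset[OF subset_UNIV finite_UNIV])

lemma finite_vector_sets [simp]: "finite (X :: 'b set set)"
  by (metis Pow_UNIV finite_Pow_iff finite_UNIV finite_subset subset_UNIV)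

lemma span_insert_subset: "subspace y \<Longrightarrow> v \<in> y \<Longrightarrow> x \<subseteq> y \<Longrightarrow> span (insert v x) \<subseteq> y"
  by (rule span_minimal) auto

lemma dim_insert_subspace: "subspace x \<Longrightarrow> v \<notin> x \<Longrightarrow> dim (insert v x) = Suc (dim x)"
  by (simp add: dim_insert span_eq_iff[THEN iffD2])

text \<open>The pairs (k, u) parametrise the span injectively: two pairs with equal image and
  different scalars would put a nonzero multiple of v, hence v itself, into x.\<close>

lemma card_span_insert:
  assumes x: "subspace x" and v: "v \<notin> x"
  shows "card (span (insert v x)) = CARD('a) * card x"
proof -
  have "inj_on (\<lambda>(k, u). u + scale k v) (UNIV \<times> x)"
  proof (rule inj_onI, clarsimp)
    fix k u l w assume *: "u \<in> x" "w \<in> x" "u + scale k v = w + scale l v"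
    then have "scale (k - l) v = w - u"
      by (simp add: scale_left_diff_distrib algebra_simps)
    then have "scale (k - l) v \<in> x"
      using x * by (simp add: subspace_diff)
    then have "scale (inverse (k - l)) (scale (k - l) v) \<in> x"
      by (rule subspace_scale[OF x])
    then have "k = l"
      using v by (cases "k = l") simp_all
    then show "k = l \<and> u = w" using * by simp
  qed
  then show ?thesis
    by (simp add: span_insert_image[OF x] card_image card_cartesian_product)
qed

lemma card_subspace:
  assumes "subspace x"
  shows "card x = CARD('a) ^ dim x"
proof -
  have "card (span B) = CARD('a) ^ card B" if "finite B" "independent B" for B
    using that
  proof (induction B rule: finite_induct)
    case (insert a B)
    have "a \<notin> span B" "independent B"
      using insert by (auto simp: independent_insert)
    then show ?case
      using insert by (simp add: card_span_insert span_insert_span[of a B])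
  qed simp
  moreover obtain B where "B \<subseteq> x" "independent B" "x \<subseteq> span B" "card B = dim x"
    using basis_exists[of x] by auto
  moreover have "span B = x"
    using calculation assms by (intro span_subspace)
  ultimately show ?thesis
    by (metis finiteI_independent)
qed

lemma span_insert_eq:
  assumes "subspace x" "subspace y" "x \<subseteq> y" "dim y = Suc (dim x)" "v \<in> y" "v \<notin> x"
  shows "span (insert v x) = y"
  using assms by (intro subspace_dim_equal span_insert_subset) (simp_all add: dim_insert_subspace)

lemma subspace_eq_dim:
  assumes "subspace x" "subspace y" "x \<subseteq> y" "dim y \<le> dim x"
  shows "x = y"
  using assms by (intro subspace_dim_equal) auto

lemma dim_span_Un:
  assumes "subspace x" "subspace y"
  shows "dim (span (x \<union> y)) + dim (x \<inter> y) = dim x + dim y"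
  using dim_sums_Int[OF assms] assms by (simp add: span_Un span_eq_iff[THEN iffD2])

text \<open>Each y is spanned by x and any one of its vectors outside x, so different y share no
  vector outside x. Upper covers and middle elements of intervals are counted below by counting
  vectors in this way.\<close>

lemma card_Union_covers:
  assumes x: "subspace x"
    and Y: "\<And>y. y \<in> Y \<Longrightarrow> subspace y \<and> x \<subseteq> y \<and> dim y = Suc (dim x)"
  shows "card (\<Union>y\<in>Y. y - x) = card Y * (CARD('a) ^ Suc (dim x) - CARD('a) ^ dim x)"
proof -
  have "card (\<Union>y\<in>Y. y - x) = (\<Sum>y\<in>Y. card (y - x))"
  proof (rule card_UN_disjoint; (intro ballI impI)?)
    fix y z assume *: "y \<in> Y" "z \<in> Y" "y \<noteq> z"
    show "(y - x) \<inter> (z - x) = {}"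
      using span_insert_eq[of x y] span_insert_eq[of x z] Y[OF *(1)] Y[OF *(2)] x *(3) by blast
  qed auto
  also have "\<dots> = (\<Sum>y\<in>Y. CARD('a) ^ Suc (dim x) - CARD('a) ^ dim x)"
    using x Y by (intro sum.cong) (auto simp: card_Diff_subset card_subspace)
  finally show ?thesis by simp
qed

section \<open>The poset and the numbers of its covers\<close>

abbreviation P :: "'b set set" where "P \<equiv> att_poset scale h"

abbreviation cov (infix "\<lessdot>" 50) where "x \<lessdot> y \<equiv> covered_by P x y"

lemma P_iff: "x \<in> P \<longleftrightarrow> subspace x \<and> x \<inter> h = {0}"
  by (simp add: att_poset_def)

lemma P_subspace [simp, dest]: "x \<in> P \<Longrightarrow> subspace x"
  by (simp add: P_iff)

lemma P_down: "y \<in> P \<Longrightarrow> subspace x \<Longrightarrow> x \<subseteq> y \<Longrightarrow> x \<in> P"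
  using subspace_0[of x] subspace_0[OF subspace_h] by (auto simp: P_iff)

text \<open>The sum of x and h is direct, so dim x + M is at most N + M.\<close>

lemma dim_P_le: "x \<in> P \<Longrightarrow> dim x \<le> N"
proof -
  assume x: "x \<in> P"
  have "dim (span (x \<union> h)) \<le> N + M"
    using dim_subset_UNIV[of "span (x \<union> h)"] dim_UNIV dim_whole by (simp add: dimension_def)
  then show ?thesis
    using dim_span_Un[of x h] x subspace_h by (simp add: P_iff dim_h)
qed

text \<open>A vector v of y outside x generates with x an intermediate subspace of dimension one
  more. It belongs to \<open>P\<close> because \<open>P\<close> is closed under taking subspaces, so
  it must be y.\<close>

lemma covered_iff: "x \<lessdot> y \<longleftrightarrow> x \<in> P \<and> y \<in> P \<and> x \<subseteq> y \<and> dim y = Suc (dim x)"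
proof
  assume xy: "x \<lessdot> y"
  then obtain v where v: "v \<in> y" "v \<notin> x" "x \<in> P" "y \<in> P" "x \<subset> y"
    by (auto simp: covered_by_def)
  define z where "z = span (insert v x)"
  have z: "z \<subseteq> y"
    unfolding z_def using v by (intro span_insert_subset) auto
  then have "z \<in> P"
    using v(4) by (rule P_down[rotated 2]) (simp add: z_def)
  moreover have "x \<subset> z"
    using v span_superset[of "insert v x"] by (auto simp: z_def)
  ultimately have "z = y"
    using xy z by (auto simp: covered_by_def)
  then show "x \<in> P \<and> y \<in> P \<and> x \<subseteq> y \<and> dim y = Suc (dim x)"
    using v dim_insert_subspace[of x v] by (auto simp: z_def)
next
  assume xy: "x \<in> P \<and> y \<in> P \<and> x \<subseteq> y \<and> dim y = Suc (dim x)"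
  have "\<not> (x \<subset> z \<and> z \<subset> y)" if "z \<in> P" for z
    using xy that subspace_eq_dim[of x z] subspace_eq_dim[of z y]
    by (metis P_subspace not_less_eq_eq order_less_imp_le psubset_eq)
  then show "x \<lessdot> y"
    using xy by (auto simp: covered_by_def)
qed

text \<open>A vector together with x spans a cover of x exactly if it lies outside x + h, which has
  q^(dim x + M) elements. The result is left as a product, free of division.\<close>

lemma card_up_covers:
  assumes x: "x \<in> P"
  shows "card {y. x \<lessdot> y} * (CARD('a) ^ Suc (dim x) - CARD('a) ^ dim x) = CARD('a) ^ (N + M) - CARD('a) ^ (dim x + M)"
proof -
  let ?S = "span (x \<union> h)"
  have sub: "subspace x" and xh: "x \<inter> h = {0}"
    using x by (auto simp: P_iff)
  then have sx: "span x = x" by simp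
  have mem: "u \<in> ?S \<longleftrightarrow> (\<exists>a\<in>x. \<exists>b\<in>h. u = a + b)" for u
    using sub subspace_h by (auto simp: span_Un span_eq_iff[THEN iffD2])
  have "(\<Union>y\<in>{y. x \<lessdot> y}. y - x) = UNIV - ?S"
  proof safe
    fix v y assume v: "x \<lessdot> y" "v \<in> y" "v \<in> ?S" "v \<notin> x"
    then obtain a b where ab: "a \<in> x" "b \<in> h" "v = a + b"
      by (auto simp: mem)
    then have "v - a \<in> y"
      using v by (intro subspace_diff) (auto simp: covered_iff)
    then have "b = 0"
      using ab v by (auto simp: covered_iff P_iff)
    then show False using ab v by simp
  next
    fix v assume v: "v \<notin> ?S"
    define y where "y = span (insert v x)"
    have "v \<notin> x"
      using v span_base[of v "x \<union> h"] by auto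
    have "u = 0" if u: "u \<in> y" "u \<in> h" for u
    proof -
      obtain k where k: "u - scale k v \<in> x"
        using u(1) by (auto simp: y_def span_insert sx)
      have "k = 0"
      proof (rule ccontr)
        assume "k \<noteq> 0"
        have "u - (u - scale k v) \<in> ?S"
          by (intro span_diff span_base) (use u k in auto)
        then have "scale (inverse k) (scale k v) \<in> ?S"
          using span_scale[of "scale k v" "x \<union> h" "inverse k"] by simp
        then show False using v \<open>k \<noteq> 0\<close> by simp
      qed
      then show "u = 0" using k u xh by auto
    qed
    then have "y \<in> P"
      using subspace_0[OF subspace_h] by (auto simp: P_iff y_def span_zero)
    then have "x \<lessdot> y" "v \<in> y"
      using x \<open>v \<notin> x\<close> span_superset[of "insert v x"]
      by (auto simp: covered_iff dim_insert_subspace[OF sub] y_def)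
    then show "v \<in> (\<Union>y\<in>{y. x \<lessdot> y}. y - x)"
      using \<open>v \<notin> x\<close> by auto
  qed auto
  moreover have "card (UNIV - ?S) = CARD('a) ^ (N + M) - CARD('a) ^ (dim x + M)"
    using dim_span_Un[OF sub subspace_h] xh
    by (simp add: card_Diff_subset card_subspace card_bas dim_h)
  ultimately show ?thesis
    using card_Union_covers[of x "{y. x \<lessdot> y}"] sub by (auto simp: covered_iff)
qed

lemma coverD:
  assumes "x \<lessdot> y"
  shows "x \<in> P" "y \<in> P" "x \<subseteq> y" "dim y = Suc (dim x)"
  using assms by (simp_all add: covered_iff)

lemma coverI: "y \<in> P \<Longrightarrow> subspace x \<Longrightarrow> x \<subseteq> y \<Longrightarrow> dim y = Suc (dim x) \<Longrightarrow> x \<lessdot> y"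
  using P_down[of y x] by (simp add: covered_iff)

text \<open>The middle elements are the points of a projective line over the field: all subspaces
  between u and y are in \<open>P\<close>, and the vectors of y outside u are distributed evenly
  among them.\<close>

lemma card_between:
  assumes "subspace u" "y \<in> P" "u \<subseteq> y" "dim y = Suc (Suc (dim u))"
  shows "card {w. u \<lessdot> w \<and> w \<lessdot> y} = CARD('a) + 1"
proof -
  have u: "u \<in> P" using assms P_down[OF assms(2), of u] by simp
  have "(\<Union>w\<in>{w. u \<lessdot> w \<and> w \<lessdot> y}. w - u) = y - u"
  proof safe
    fix v assume v: "v \<in> y" "v \<notin> u"
    define w where "w = span (insert v u)"
    have "w \<subseteq> y"
      unfolding w_def using v assms by (intro span_insert_subset) auto
    then have "w \<in> P"
      using P_down[OF assms(2), of w] by (simp add: w_def)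
    moreover have w: "dim w = Suc (dim u)" "u \<subseteq> w" "v \<in> w"
      using v assms(1) span_superset[of "insert v u"] by (auto simp: w_def dim_insert_subspace)
    ultimately have "u \<lessdot> w" "w \<lessdot> y"
      using assms u \<open>w \<subseteq> y\<close> by (simp_all add: covered_iff)
    then show "v \<in> (\<Union>w\<in>{w. u \<lessdot> w \<and> w \<lessdot> y}. w - u)"
      using v w by blast
  qed (use assms(3) in \<open>auto dest: coverD(3)\<close>)
  then have "card {w. u \<lessdot> w \<and> w \<lessdot> y} * (CARD('a) ^ Suc (dim u) - CARD('a) ^ dim u) = card (y - u)"
    using card_Union_covers[of u "{w. u \<lessdot> w \<and> w \<lessdot> y}"] assms(1) by (simp add: covered_iff)
  also have "\<dots> = CARD('a) ^ Suc (Suc (dim u)) - CARD('a) ^ dim u"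
    using assms by (simp add: card_Diff_subset card_subspace)
  also have "\<dots> = (CARD('a) + 1) * (CARD('a) ^ Suc (dim u) - CARD('a) ^ dim u)"
    by (simp add: algebra_simps diff_mult_distrib2)
  finally show ?thesis
    using power_strict_increasing[of "dim u" "Suc (dim u)" "CARD('a)"] q_ge_2
    by (subst (asm) mult_right_cancel) simp_all
qed

text \<open>Distinct hyperplanes of y span more than either of them, hence y; the dimension formula
  then gives the intersection.\<close>

lemma dim_Int_hyperplanes:
  assumes "subspace x" "subspace w" "subspace y" "x \<subseteq> y" "w \<subseteq> y" "x \<noteq> w"
    and "dim y = Suc (dim x)" "dim w = dim x"
  shows "Suc (dim (x \<inter> w)) = dim x" "span (x \<union> w) = y"
proof -
  have "span (x \<union> w) \<subseteq> y"
    using assms by (intro span_minimal) auto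
  moreover have "dim (span (x \<union> w)) > dim x"
  proof (rule ccontr)
    assume "\<not> dim (span (x \<union> w)) > dim x"
    then have "x = span (x \<union> w)" "w = span (x \<union> w)"
      using assms span_superset[of "x \<union> w"]
      by (intro subspace_eq_dim; simp)+
    then show False using assms(6) by simp
  qed
  ultimately show eq: "span (x \<union> w) = y"
    using assms by (intro subspace_eq_dim) auto
  then show "Suc (dim (x \<inter> w)) = dim x"
    using dim_span_Un[of x w] assms by simp
qed

text \<open>A hyperplane w of y other than x determines u = x \<inter> w below x, and each u arises
  from the q middle elements of the interval from u to y that differ from x.\<close>

lemma card_down_covers:
  assumes xy: "x \<lessdot> y"
  shows "card {w. w \<lessdot> y} = CARD('a) * card {u. u \<lessdot> x} + 1"
proof -
  have eq: "{w. w \<lessdot> y} - {x} = (\<Union>u\<in>{u. u \<lessdot> x}. {w. u \<lessdot> w \<and> w \<lessdot> y} - {x})"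
  proof (intro equalityI subsetI)
    fix w assume "w \<in> {w. w \<lessdot> y} - {x}"
    then have w: "w \<lessdot> y" "w \<noteq> x" by auto
    have "Suc (dim (x \<inter> w)) = dim x"
      using w xy by (intro dim_Int_hyperplanes(1)[of x w y]) (auto simp: covered_iff)
    moreover have "x \<inter> w \<in> P"
      using P_down[of x "x \<inter> w"] w xy by (simp add: covered_iff subspace_inter)
    ultimately have "x \<inter> w \<lessdot> x" "x \<inter> w \<lessdot> w"
      using xy w by (auto simp: covered_iff)
    then show "w \<in> (\<Union>u\<in>{u. u \<lessdot> x}. {w. u \<lessdot> w \<and> w \<lessdot> y} - {x})"
      using w by blast
  qed auto
  have "card ({w. w \<lessdot> y} - {x}) = (\<Sum>u\<in>{u. u \<lessdot> x}. card ({w. u \<lessdot> w \<and> w \<lessdot> y} - {x}))"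
    unfolding eq
  proof (rule card_UN_disjoint; (intro ballI impI)?)
    fix u u' assume u: "u \<in> {u. u \<lessdot> x}" "u' \<in> {u. u \<lessdot> x}" "u \<noteq> u'"
    have "span (u \<union> u') = z" if "u \<lessdot> z" "u' \<lessdot> z" for z
      using that u(3) by (intro dim_Int_hyperplanes(2)) (simp_all add: covered_iff)
    then show "({w. u \<lessdot> w \<and> w \<lessdot> y} - {x}) \<inter> ({w. u' \<lessdot> w \<and> w \<lessdot> y} - {x}) = {}"
      using u(1,2) by blast
  qed auto
  also have "\<dots> = (\<Sum>u\<in>{u. u \<lessdot> x}. CARD('a))"
  proof (rule sum.cong, simp)
    fix u assume u: "u \<in> {u. u \<lessdot> x}"
    then have "card {w. u \<lessdot> w \<and> w \<lessdot> y} = CARD('a) + 1"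
      using xy by (intro card_between) (auto simp: covered_iff)
    then show "card ({w. u \<lessdot> w \<and> w \<lessdot> y} - {x}) = CARD('a)"
      using u xy by (subst card_Diff_singleton) auto
  qed
  finally show ?thesis
    using xy card_Suc_Diff1[of "{w. w \<lessdot> y}" x] by (simp add: mult.commute)
qed

text \<open>Subtract the two explicit counts, in the integers, and cancel a common factor. The
  difference is the diagonal entry of \<open>K\<close> at y, which is how \<open>L K\<close> enters
  the cubic relation.\<close>

lemma card_up_covers_diff:
  assumes xy: "x \<lessdot> y"
  shows "card {z. x \<lessdot> z} = card {z. y \<lessdot> z} + CARD('a) ^ (N + M - dim y)"
proof -
  define d where "d = dim x"
  have d: "dim y = Suc d" "Suc d \<le> N"
    using xy dim_P_le[of y] by (auto simp: covered_iff d_def)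
  define Q where "Q = int CARD('a)"
  have Q: "Q \<ge> 2" using q_ge_2 by (simp add: Q_def)
  have le: "CARD('a) ^ i \<le> CARD('a) ^ j" if "i \<le> j" for i j
    using that q_ge_2 by (intro power_increasing) auto
  have x: "int (card {z. x \<lessdot> z}) * (Q ^ Suc d - Q ^ d) = Q ^ (N + M) - Q ^ (d + M)"
    using arg_cong[OF card_up_covers[of x], of int] xy d le
    by (simp add: covered_iff of_nat_diff d_def[symmetric] Q_def del: power_Suc)
  have y: "int (card {z. y \<lessdot> z}) * (Q ^ Suc (Suc d) - Q ^ Suc d) = Q ^ (N + M) - Q ^ (Suc d + M)"
    using arg_cong[OF card_up_covers[of y], of int] xy d le
    by (simp add: covered_iff of_nat_diff Q_def del: power_Suc add_Suc)
  have "Q ^ (N + M) = Q ^ (N + M - Suc d) * Q ^ Suc d"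
    using d by (simp flip: power_add del: power_Suc)
  then have "(Q ^ d * (Q - 1) * Q) * int (card {z. x \<lessdot> z}) =
      (Q ^ d * (Q - 1) * Q) * (int (card {z. y \<lessdot> z}) + Q ^ (N + M - Suc d))"
    using arg_cong[OF x, of "\<lambda>a. Q * a"] y by (simp add: algebra_simps)
  then have "int (card {z. x \<lessdot> z}) = int (card {z. y \<lessdot> z}) + Q ^ (N + M - Suc d)"
    using Q by (subst (asm) mult_left_cancel) auto
  then show ?thesis
    by (simp add: d Q_def) (metis of_nat_add of_nat_eq_iff of_nat_power)
qed

section \<open>Walks of length three\<close>

lemma dim_not_subset_Int:
  assumes "subspace x" "subspace y" "\<not> x \<subseteq> y"
  shows "dim (x \<inter> y) < dim x"
proof (rule ccontr)
  assume "\<not> dim (x \<inter> y) < dim x"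
  then have "x \<inter> y = x"
    using assms by (intro subspace_eq_dim) (auto simp: subspace_inter)
  then show False using assms by blast
qed

text \<open>x \<inter> y is a proper subspace of x that contains the hyperplane u of x.\<close>

lemma meet_eq:
  assumes "u \<lessdot> x" "subspace y" "u \<subseteq> y" "\<not> x \<subseteq> y"
  shows "u = x \<inter> y"
proof (rule subspace_eq_dim)
  show "dim (x \<inter> y) \<le> dim u"
    using dim_not_subset_Int[of x y] assms by (simp add: covered_iff)
qed (use assms in \<open>auto simp: covered_iff subspace_inter\<close>)

lemma join_eq:
  assumes "x \<lessdot> z" "w \<lessdot> z" "x \<noteq> w"
  shows "span (x \<union> w) = z" "x \<inter> w \<lessdot> x" "x \<inter> w \<lessdot> w"
proof -
  have xw: "subspace x" "subspace w" "subspace z" "x \<subseteq> z" "w \<subseteq> z"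
    "dim z = Suc (dim x)" "dim w = dim x"
    using assms by (simp_all add: covered_iff)
  show "span (x \<union> w) = z"
    using xw assms(3) by (intro dim_Int_hyperplanes(2)) simp_all
  have "Suc (dim (x \<inter> w)) = dim x"
    using xw assms(3) by (intro dim_Int_hyperplanes(1)[of _ _ z]) simp_all
  then show "x \<inter> w \<lessdot> x" "x \<inter> w \<lessdot> w"
    using xw assms by (auto intro!: coverI dest: coverD simp: subspace_inter)
qed

lemma card_between_covers:
  assumes "u \<lessdot> v" "v \<lessdot> y"
  shows "card {w. u \<lessdot> w \<and> w \<lessdot> y} = CARD('a) + 1"
proof -
  have "u \<subseteq> v" "v \<subseteq> y" "subspace u" "y \<in> P" "dim y = Suc (Suc (dim u))"
    using assms by (simp_all add: covered_iff)
  then show ?thesis by (intro card_between) blast+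
qed

lemma card_pairs:
  assumes "\<And>a b. R a b \<longleftrightarrow> a \<in> A \<and> b \<in> B a" "\<And>a. a \<in> A \<Longrightarrow> card (B a) = k"
    and "finite A" "\<And>a. finite (B a)"
  shows "card {(a, b). R a b} = card A * k"
proof -
  have "{(a, b). R a b} = Sigma A B"
    using assms(1) by auto
  then show ?thesis
    using assms by simp
qed

text \<open>
  For \<open>x \<lessdot> y\<close> every walk counted on the left passes through \<open>y\<close> first or through \<open>x\<close> last.
\<close>

lemma walk_count_covers:
  assumes xy: "x \<lessdot> y"
  shows "(CARD('a) + 1) * card {(z, w). x \<lessdot> z \<and> w \<lessdot> z \<and> w \<lessdot> y} =
    CARD('a) * card {(u, z). u \<lessdot> x \<and> u \<lessdot> z \<and> z \<lessdot> y} +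
    card {(b, a). y \<lessdot> b \<and> x \<lessdot> a \<and> a \<lessdot> b} +
    (CARD('a) + 1) * CARD('a) ^ (N + M - dim y)"
proof -
  have "{(z, w). x \<lessdot> z \<and> w \<lessdot> z \<and> w \<lessdot> y} =
      {y} \<times> {w. w \<lessdot> y} \<union> ({z. x \<lessdot> z} - {y}) \<times> {x}"
  proof -
    have "w = x" if "x \<lessdot> z" "w \<lessdot> z" "w \<lessdot> y" "z \<noteq> y" for z w
      using that xy join_eq(1)[of x z w] join_eq(1)[of x y w] by blast
    then show ?thesis using xy by blast
  qed
  moreover have "card ({y} \<times> {w. w \<lessdot> y} \<union> ({z. x \<lessdot> z} - {y}) \<times> {x}) =
      card ({y} \<times> {w. w \<lessdot> y}) + card (({z. x \<lessdot> z} - {y}) \<times> {x})"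
    by (intro card_Un_disjoint) auto
  \<comment> \<open>The walk with z = y and w = x belongs to both families, hence the 1 on the
    left.\<close>
  ultimately have A: "card {(z, w). x \<lessdot> z \<and> w \<lessdot> z \<and> w \<lessdot> y} + 1 = card {w. w \<lessdot> y} + card {z. x \<lessdot> z}"
    using xy card_Suc_Diff1[of "{z. x \<lessdot> z}" y] by (simp add: card_cartesian_product)
  have B: "card {(u, z). u \<lessdot> x \<and> u \<lessdot> z \<and> z \<lessdot> y} = card {u. u \<lessdot> x} * (CARD('a) + 1)"
    using card_between_covers[OF _ xy]
    by (intro card_pairs[of _ _ "\<lambda>u. {z. u \<lessdot> z \<and> z \<lessdot> y}"]) auto
  have C: "card {(b, a). y \<lessdot> b \<and> x \<lessdot> a \<and> a \<lessdot> b} = card {b. y \<lessdot> b} * (CARD('a) + 1)"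
    using card_between_covers[OF xy]
    by (intro card_pairs[of _ _ "\<lambda>b. {a. x \<lessdot> a \<and> a \<lessdot> b}"]) auto
  have A': "card {(z, w). x \<lessdot> z \<and> w \<lessdot> z \<and> w \<lessdot> y} =
      CARD('a) * card {u. u \<lessdot> x} + card {z. y \<lessdot> z} + CARD('a) ^ (N + M - dim y)"
    using A card_down_covers[OF xy] card_up_covers_diff[OF xy] by linarith
  show ?thesis
    unfolding A' B C by (simp add: algebra_simps)
qed

text \<open>If x + y meets h trivially, then so does every x + w. Otherwise (x + y) \<inter> h is a
  line, spanned by some t = a + b with a in x and b in y, and x + w meets h exactly if w contains b.
  Since u = x \<inter> y, the span of u and b is the only w to be excluded.\<close>

lemma card_between_join:
  assumes ux: "u \<lessdot> x" and uv: "u \<lessdot> v" "v \<lessdot> y" and nxy: "\<not> x \<subseteq> y"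
  shows "card {w. (u \<lessdot> w \<and> w \<lessdot> y) \<and> span (x \<union> w) \<in> P} =
    CARD('a) + (if span (x \<union> y) \<in> P then 1 else 0)"
proof (cases "span (x \<union> y) \<in> P")
  case True
  have "span (x \<union> w) \<in> P" if "w \<lessdot> y" for w
    using coverD(3)[OF that] by (intro P_down[OF True] subspace_span span_mono) auto
  then have "{w. (u \<lessdot> w \<and> w \<lessdot> y) \<and> span (x \<union> w) \<in> P} = {w. u \<lessdot> w \<and> w \<lessdot> y}"
    by auto
  then show ?thesis
    using card_between_covers[OF uv] True by simp
next
  case False
  note c = coverD[OF ux] coverD[OF uv(1)] coverD[OF uv(2)]
  have sub: "subspace x" "subspace y" "subspace u" "span x = x" "span y = y"
    using c by auto
  have u: "u = x \<inter> y"
    using meet_eq[OF ux _ _ nxy] c by auto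
  have mem: "t \<in> span (x \<union> w) \<longleftrightarrow> (\<exists>a\<in>x. \<exists>b\<in>w. t = a + b)" if "subspace w" for t w
  proof -
    have "span w = w" using that by simp
    then have "span (x \<union> w) = {a + b |a b. a \<in> x \<and> b \<in> w}"
      by (simp only: span_Un sub(4))
    then show ?thesis by blast
  qed
  have "0 \<in> span (x \<union> y) \<inter> h"
    using subspace_0[OF subspace_h] by (simp add: span_zero)
  then obtain t where t: "t \<in> span (x \<union> y)" "t \<in> h" "t \<noteq> 0"
    using False by (auto simp: P_iff)
  then obtain a b where ab: "a \<in> x" "b \<in> y" "t = a + b"
    using mem[OF sub(2)] by auto
  have xh: "x \<inter> h = {0}" and yh: "y \<inter> h = {0}"
    using c by (auto simp: P_iff)
  have bx: "b \<notin> x"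
    using ab t xh subspace_add[OF sub(1), of a b] by auto
  have ty: "t \<notin> y"
    using t yh by auto
  have dim: "dim (span (x \<union> y)) = Suc (dim y)"
    using dim_span_Un[OF sub(1,2)] c u by simp
  have t_span: "span (insert t y) = span (x \<union> y)"
    using t ty sub dim by (intro span_insert_eq) (auto intro: span_base)
  define w0 where "w0 = span (insert b u)"
  have w0: "subspace w0" "w0 \<subseteq> y" "u \<subseteq> w0" "dim w0 = Suc (dim u)" "b \<in> w0"
    using ab bx u sub span_superset[of "insert b u"] span_insert_subset[OF sub(2) ab(2), of u]
      dim_insert_subspace[OF sub(3), of b]
    by (auto simp: w0_def)
  have w0_cov: "u \<lessdot> w0" "w0 \<lessdot> y"
    using w0 c P_down[of y w0] by (simp_all add: covered_iff)
  have "t \<in> span (x \<union> w0)"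
    using ab w0 by (auto simp: mem)
  then have w0P: "span (x \<union> w0) \<notin> P"
    using t by (auto simp: P_iff)
  have "w = w0" if w: "u \<lessdot> w" "w \<lessdot> y" "span (x \<union> w) \<notin> P" for w
  proof -
    have sw: "subspace w" "w \<subseteq> y" "u \<subseteq> w" "dim w = Suc (dim u)"
      using coverD[OF w(1)] coverD[OF w(2)] by auto
    have "0 \<in> span (x \<union> w) \<inter> h"
      using subspace_0[OF subspace_h] by (simp add: span_zero)
    then obtain s where s: "s \<in> span (x \<union> w)" "s \<in> h" "s \<noteq> 0"
      using w by (auto simp: P_iff)
    then obtain a' b' where ab': "a' \<in> x" "b' \<in> w" "s = a' + b'"
      using mem[OF sw(1)] by auto
    have "s \<in> span (insert t y)"
      using s(1) span_mono[of "x \<union> w" "x \<union> y"] sw(2) t_span by auto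
    \<comment> \<open>As x + y is y extended by t and y \<inter> h = 0, every vector s of h in x + y
      is a multiple of t.\<close>
    then obtain k where k: "s - scale k t \<in> y"
      by (auto simp: span_insert sub(5))
    then have "s - scale k t \<in> y \<inter> h"
      using s t by (simp add: subspace_diff subspace_scale subspace_h)
    then have sk: "s = scale k t"
      using yh by simp
    then have "k \<noteq> 0" using s by auto
    have "b' - scale k b = scale k a - a'"
      using sk ab ab' by (simp add: scale_right_distrib algebra_simps)
    moreover have "scale k a - a' \<in> x"
      using ab ab' sub by (simp add: subspace_diff subspace_scale)
    moreover have "b' - scale k b \<in> y"
      using ab ab' sw sub by (intro subspace_diff subspace_scale) auto
    ultimately have "b' - scale k b \<in> w"
      using u sw by auto
    then have "b' - (b' - scale k b) \<in> w"
      by (rule subspace_diff[OF sw(1) ab'(2)])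
    then have "b \<in> w"
      using subspace_scale[OF sw(1), of "scale k b" "inverse k"] \<open>k \<noteq> 0\<close> by simp
    then have "w0 \<subseteq> w"
      unfolding w0_def using sw by (intro span_insert_subset)
    then show "w = w0"
      using sw w0 by (intro subspace_eq_dim[symmetric]) simp_all
  qed
  then have "{w. (u \<lessdot> w \<and> w \<lessdot> y) \<and> span (x \<union> w) \<in> P} = {w. u \<lessdot> w \<and> w \<lessdot> y} - {w0}"
    using w0P w0_cov by blast
  then show ?thesis
    using card_between_covers[OF uv] w0_cov False by simp
qed

text \<open>If y lies two steps above x \<inter> y and x one step above it, the three numbers of
  walks are q + c, q + 1 and c (q + 1), where c is 1 or 0 according to whether x + y is in
  \<open>P\<close>; and (q + 1)(q + c) = q (q + 1) + c (q + 1). In all other positions there are no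
  walks at all.\<close>

lemma walk_count_not_covers:
  assumes nxy: "\<not> x \<lessdot> y"
  shows "(CARD('a) + 1) * card {(z, w). x \<lessdot> z \<and> w \<lessdot> z \<and> w \<lessdot> y} =
    CARD('a) * card {(u, z). u \<lessdot> x \<and> u \<lessdot> z \<and> z \<lessdot> y} +
    card {(b, a). y \<lessdot> b \<and> x \<lessdot> a \<and> a \<lessdot> b}"
proof (cases "x \<inter> y \<lessdot> x \<and> (\<exists>v. x \<inter> y \<lessdot> v \<and> v \<lessdot> y)")
  case True
  then obtain v where u: "x \<inter> y \<lessdot> x" "x \<inter> y \<lessdot> v" "v \<lessdot> y" by blast
  define J where "J = span (x \<union> y)"
  have sub: "subspace x" "subspace y" "dim y = Suc (dim x)" "dim x = Suc (dim (x \<inter> y))" "x \<in> P" "y \<in> P"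
    using coverD[OF u(1)] coverD[OF u(2)] coverD[OF u(3)] by simp_all
  have nsub: "\<not> x \<subseteq> y"
    using nxy sub by (simp add: covered_iff)
  have ne: "w \<noteq> x" if "w \<lessdot> y" for w
    using that nxy by auto
  have meet: "u' = x \<inter> y" if "u' \<lessdot> x" "u' \<subseteq> y" for u'
    using meet_eq[OF that(1) sub(2) that(2) nsub] .
  have dimJ: "dim J = Suc (dim y)"
    using dim_span_Un[of x y] sub by (simp add: J_def)
  have "{(z, w). x \<lessdot> z \<and> w \<lessdot> z \<and> w \<lessdot> y} =
      (\<lambda>w. (span (x \<union> w), w)) ` {w. (x \<inter> y \<lessdot> w \<and> w \<lessdot> y) \<and> span (x \<union> w) \<in> P}" (is "?A = ?f ` ?W")
  proof (intro equalityI subsetI)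
    fix p assume "p \<in> ?A"
    then obtain z w where p: "p = (z, w)" "x \<lessdot> z" "w \<lessdot> z" "w \<lessdot> y" by auto
    note j = join_eq[OF p(2,3) ne[OF p(4), symmetric]]
    have "x \<inter> w = x \<inter> y"
      using meet[OF j(2)] coverD(3)[OF p(4)] by blast
    then show "p \<in> ?f ` ?W"
      using p j coverD(2)[OF p(2)] by auto
  next
    fix p assume "p \<in> ?f ` ?W"
    then obtain w where p: "p = (span (x \<union> w), w)" "x \<inter> y \<lessdot> w" "w \<lessdot> y" "span (x \<union> w) \<in> P"
      by auto
    have sw: "subspace w" "dim w = dim x" "x \<inter> w = x \<inter> y"
      using coverD[OF p(2)] coverD[OF p(3)] sub by auto
    have "dim (span (x \<union> w)) = Suc (dim x)"
      using dim_span_Un[of x w] sw sub by simp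
    then have "x \<lessdot> span (x \<union> w)" "w \<lessdot> span (x \<union> w)"
      using p(4) sub sw span_superset[of "x \<union> w"] by (auto intro!: coverI)
    then show "p \<in> ?A"
      using p by auto
  qed
  moreover have "inj_on ?f ?W"
    by (auto simp: inj_on_def)
  ultimately have A: "card ?A = CARD('a) + (if J \<in> P then 1 else 0)"
    using card_between_join[OF u nsub] by (simp add: card_image J_def)
  have "card {(u, z). u \<lessdot> x \<and> u \<lessdot> z \<and> z \<lessdot> y} = card {x \<inter> y} * (CARD('a) + 1)"
    using card_between_covers[OF u(2,3)] u
    by (intro card_pairs[of _ _ "\<lambda>u. {z. u \<lessdot> z \<and> z \<lessdot> y}"])
      (auto dest: meet coverD(3) intro!: meet)
  then have B: "card {(u, z). u \<lessdot> x \<and> u \<lessdot> z \<and> z \<lessdot> y} = CARD('a) + 1" by simp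
  have J: "b = J" if "y \<lessdot> b" "x \<lessdot> a" "a \<lessdot> b" for a b
  proof -
    have "x \<subseteq> b" "y \<subseteq> b" "subspace b" "dim b = Suc (dim y)"
      using coverD[OF that(1)] coverD[OF that(2)] coverD[OF that(3)] by auto
    then show "b = J"
      using dimJ span_minimal[of "x \<union> y" b]
      by (intro subspace_eq_dim[symmetric]) (simp_all add: J_def)
  qed
  have JP: "J \<in> P" if "y \<lessdot> J"
    using coverD(2)[OF that] .
  have "card {(b, a). y \<lessdot> b \<and> x \<lessdot> a \<and> a \<lessdot> b} = card (if J \<in> P then {J} else {}) * (CARD('a) + 1)"
  proof (intro card_pairs[of _ _ "\<lambda>b. {a. x \<lessdot> a \<and> a \<lessdot> b}"])
    have yJ: "y \<lessdot> J" if "J \<in> P"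
      using that sub dimJ span_superset[of "x \<union> y"] by (auto intro!: coverI simp: J_def)
    then show "(y \<lessdot> b \<and> x \<lessdot> a \<and> a \<lessdot> b) \<longleftrightarrow>
        b \<in> (if J \<in> P then {J} else {}) \<and> a \<in> {a. x \<lessdot> a \<and> a \<lessdot> b}" for a b
      using J JP by auto
    show "card {a. x \<lessdot> a \<and> a \<lessdot> b} = CARD('a) + 1" if "b \<in> (if J \<in> P then {J} else {})" for b
    proof -
      have b: "b = J" "J \<in> P" using that by (auto split: if_splits)
      then show ?thesis
        using sub dimJ span_superset[of "x \<union> y"] by (intro card_between) (auto simp: J_def)
    qed
  qed auto
  then have C: "card {(b, a). y \<lessdot> b \<and> x \<lessdot> a \<and> a \<lessdot> b} = (if J \<in> P then CARD('a) + 1 else 0)"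
    by simp
  show ?thesis
    unfolding A B C by (simp add: algebra_simps)
next
  case False
  \<comment> \<open>Each kind of walk would produce the element v of the first case: it is w for the
    first kind, z for the second and y \<inter> a for the third.\<close>
  have 1: False if "x \<lessdot> z" "w \<lessdot> z" "w \<lessdot> y" for z w
  proof -
    have "x \<noteq> w" using that nxy by auto
    note j = join_eq[OF that(1,2) this]
    have "dim y = Suc (dim x)"
      using coverD[OF that(1)] coverD[OF that(2)] coverD[OF that(3)] by simp
    then have "\<not> x \<subseteq> y"
      using nxy coverD[OF that(1)] coverD[OF that(3)] by (simp add: covered_iff)
    then have "x \<inter> w = x \<inter> y"
      using meet_eq[OF j(2), of y] coverD[OF that(3)] by auto
    then show False
      using False j that by auto
  qed
  have 2: False if "u \<lessdot> x" "u \<lessdot> z" "z \<lessdot> y" for u z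
  proof -
    have c: "dim y = Suc (dim x)" "u \<subseteq> y" "x \<in> P" "y \<in> P"
      using coverD[OF that(1)] coverD[OF that(2)] coverD[OF that(3)] by auto
    then have "\<not> x \<subseteq> y"
      using nxy by (simp add: covered_iff)
    then have "u = x \<inter> y"
      using meet_eq[OF that(1), of y] c by auto
    then show False
      using False that by auto
  qed
  have 3: False if "y \<lessdot> b" "x \<lessdot> a" "a \<lessdot> b" for a b
  proof -
    have c: "dim y = Suc (dim x)" "dim b = Suc (dim y)" "x \<subseteq> b" "y \<subseteq> b" "x \<in> P" "y \<in> P" "b \<in> P"
      using coverD[OF that(1)] coverD[OF that(2)] coverD[OF that(3)] by auto
    then have nsub: "\<not> x \<subseteq> y"
      using nxy by (simp add: covered_iff)
    then have "y \<noteq> a"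
      using coverD(3)[OF that(2)] by auto
    note j = join_eq[OF that(1,3) this]
    have "dim (span (x \<union> y)) \<le> dim b"
      using c by (metis dim_subset dim_span span_minimal Un_least P_subspace)
    then have "dim (x \<inter> y) = dim (y \<inter> a) - 1"
      using dim_span_Un[of x y] c dim_not_subset_Int[OF _ _ nsub] coverD(4)[OF j(2)] by simp
    then have d: "dim x = Suc (dim (x \<inter> y))" "dim (y \<inter> a) = Suc (dim (x \<inter> y))"
      using dim_span_Un[of x y] c dim_not_subset_Int[OF _ _ nsub] coverD(4)[OF j(2)]
        \<open>dim (span (x \<union> y)) \<le> dim b\<close> by simp_all
    have "x \<inter> y \<lessdot> x"
      using c d by (intro coverI) (auto simp: subspace_inter)
    moreover have "x \<inter> y \<lessdot> y \<inter> a"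
      using coverD(1)[OF j(2)] coverD(3)[OF that(2)] c d by (intro coverI) (auto simp: subspace_inter)
    ultimately show False
      using False j(2) by auto
  qed
  have "{(z, w). x \<lessdot> z \<and> w \<lessdot> z \<and> w \<lessdot> y} = {}" "{(u, z). u \<lessdot> x \<and> u \<lessdot> z \<and> z \<lessdot> y} = {}"
    "{(b, a). y \<lessdot> b \<and> x \<lessdot> a \<and> a \<lessdot> b} = {}"
    using 1 2 3 by blast+
  then show ?thesis by (simp only: card.empty)
qed

end

section \<open>Matrices acting on vectors\<close>

lemma subspace_vecs: "vec.subspace (vecs X)"
  by (rule vec.subspaceI) (auto simp: vecs_def vec_scale_def)

lemma mat_vec_add: "mat_vec X A (v + w) = mat_vec X A v + mat_vec X A w"
  by (simp add: mat_vec_def fun_eq_iff distrib_left sum.distrib)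

lemma mat_vec_scale: "mat_vec X A (vec_scale c v) = vec_scale c (mat_vec X A v)"
  by (simp add: mat_vec_def vec_scale_def fun_eq_iff sum_distrib_left mult.left_commute)

lemma mat_vec_zero: "mat_vec X A 0 = 0"
  by (simp add: mat_vec_def fun_eq_iff)

lemma mat_vec_diff: "mat_vec X A (v - w) = mat_vec X A v - mat_vec X A w"
  by (simp add: mat_vec_def fun_eq_iff right_diff_distrib sum_subtractf)

lemma mat_vec_mat_add: "mat_vec X (A + B) v = mat_vec X A v + mat_vec X B v"
  by (simp add: mat_vec_def fun_eq_iff distrib_right sum.distrib)

lemma mat_vec_mat_diff: "mat_vec X (A - B) v = mat_vec X A v - mat_vec X B v"
  by (simp add: mat_vec_def fun_eq_iff left_diff_distrib sum_subtractf)

lemma mat_vec_mat_zero: "mat_vec X 0 v = 0"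
  by (simp add: mat_vec_def fun_eq_iff)

lemma mat_vec_mat_scale: "mat_vec X (mat_scale c A) v = vec_scale c (mat_vec X A v)"
  by (simp add: mat_vec_def mat_scale_def vec_scale_def fun_eq_iff sum_distrib_left mult.assoc)

lemma mat_vec_mat_sum: "mat_vec X (\<Sum>i\<in>I. A i) v = (\<Sum>i\<in>I. mat_vec X (A i) v)"
  by (induction I rule: infinite_finite_induct) (simp_all only: sum.infinite sum.empty sum.insert mat_vec_mat_zero mat_vec_mat_add if_False simp_thms)

lemma mat_vec_mult: "mat_vec X (mat_mult X A B) v = mat_vec X A (mat_vec X B v)"
proof (rule ext)
  fix x
  have "mat_vec X (mat_mult X A B) v x = (\<Sum>y\<in>X. \<Sum>z\<in>X. A x z * B z y * v y)"
    by (simp add: mat_vec_def mat_mult_def sum_distrib_right)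
  also have "\<dots> = (\<Sum>z\<in>X. \<Sum>y\<in>X. A x z * B z y * v y)"
    by (rule sum.swap)
  also have "\<dots> = mat_vec X A (mat_vec X B v) x"
    by (simp add: mat_vec_def sum_distrib_left mult.assoc)
  finally show "mat_vec X (mat_mult X A B) v x = mat_vec X A (mat_vec X B v) x" .
qed

lemma mat_vec_diag:
  assumes "finite X"
  shows "mat_vec X (\<lambda>x y. if x = y \<and> C y then g y else 0) v =
    (\<lambda>x. if x \<in> X \<and> C x then g x * v x else 0)"
proof (rule ext)
  fix x
  have "(\<Sum>y\<in>X. (if x = y \<and> C y then g y else 0) * v y) =
      (\<Sum>y\<in>X. if y = x then (if C x then g x * v x else 0) else 0)"
    by (rule sum.cong) auto
  also have "\<dots> = (if x \<in> X \<and> C x then g x * v x else 0)"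
    using assms by simp
  finally show "mat_vec X (\<lambda>x y. if x = y \<and> C y then g y else 0) v x =
      (if x \<in> X \<and> C x then g x * v x else 0)"
    by (simp add: mat_vec_def)
qed

lemma mat_vec_one:
  assumes "finite X" "v \<in> vecs X"
  shows "mat_vec X (mat_one X) v = v"
proof -
  have "mat_one X = (\<lambda>x y. if x = y \<and> y \<in> X then 1 else 0)"
    by (auto simp: mat_one_def fun_eq_iff)
  then have "mat_vec X (mat_one X) v = (\<lambda>x. if x \<in> X \<and> x \<in> X then 1 * v x else 0)"
    using mat_vec_diag[OF assms(1)] by (simp only:)
  then show ?thesis
    using assms(2) by (auto simp: vecs_def fun_eq_iff)
qed

lemma mat_vec_vecs: "A \<in> mats X \<Longrightarrow> mat_vec X A v \<in> vecs X"
  by (auto simp: mats_def vecs_def mat_vec_def)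

lemma mats_closed:
  "0 \<in> mats X" "mat_one X \<in> mats X"
  "A \<in> mats X \<Longrightarrow> B \<in> mats X \<Longrightarrow> A + B \<in> mats X"
  "A \<in> mats X \<Longrightarrow> B \<in> mats X \<Longrightarrow> A - B \<in> mats X"
  "A \<in> mats X \<Longrightarrow> B \<in> mats X \<Longrightarrow> mat_mult X A B \<in> mats X"
  "A \<in> mats X \<Longrightarrow> mat_scale c A \<in> mats X"
  by (auto simp: mats_def mat_one_def mat_mult_def mat_scale_def)

lemma mats_sum: "(\<And>i. i \<in> I \<Longrightarrow> A i \<in> mats X) \<Longrightarrow> (\<Sum>i\<in>I. A i) \<in> mats X"
  by (induction I rule: infinite_finite_induct) (simp_all add: mats_closed del: plus_fun_apply)

lemma mats_eqI:
  assumes "finite X" "A \<in> mats X" "B \<in> mats X" "\<And>v. v \<in> vecs X \<Longrightarrow> mat_vec X A v = mat_vec X B v"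
  shows "A = B"
proof (intro ext)
  fix x y
  show "A x y = B x y"
  proof (cases "y \<in> X")
    case True
    have "mat_vec X C (\<lambda>z. if z = y then 1 else 0) x = C x y" for C
    proof -
      have "(\<Sum>z\<in>X. C x z * (if z = y then 1 else 0)) = (\<Sum>z\<in>X. if z = y then C x z else 0)"
        by (rule sum.cong) auto
      then show ?thesis using assms(1) True by (simp add: mat_vec_def)
    qed
    moreover have "(\<lambda>z. if z = y then 1 else 0) \<in> vecs X"
      using True by (auto simp: vecs_def)
    ultimately show ?thesis
      using assms(4) by metis
  qed (use assms(2,3) in \<open>auto simp: mats_def\<close>)
qed

lemma mat_inv_eq:
  assumes X: "finite X" and A: "A \<in> mats X" and B: "B \<in> mats X"
    and AB: "mat_mult X A B = mat_one X" "mat_mult X B A = mat_one X"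
  shows "mat_inv X A = B"
  unfolding mat_inv_def
proof (rule the_equality)
  fix C assume C: "C \<in> mats X \<and> mat_mult X A C = mat_one X \<and> mat_mult X C A = mat_one X"
  show "C = B"
  proof (rule mats_eqI[OF X _ B])
    fix v assume v: "v \<in> vecs X"
    have "mat_vec X C v = mat_vec X C (mat_vec X A (mat_vec X B v))"
      using v X by (simp add: AB mat_vec_one flip: mat_vec_mult)
    also have "\<dots> = mat_vec X B v"
      using C X B by (simp add: mat_vec_one mat_vec_vecs flip: mat_vec_mult[of X C])
    finally show "mat_vec X C v = mat_vec X B v" .
  qed (use C in simp)
qed (use assms in simp)

lemma mat_subalgebra_mats: "mat_subalgebra X (mats X)"
  by (auto simp: mat_subalgebra_def mats_closed simp del: plus_fun_apply)

lemma mat_subalgebra_stabilizer: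
  assumes "finite X" "vec.subspace U" "U \<subseteq> vecs X"
  shows "mat_subalgebra X {A \<in> mats X. \<forall>u\<in>U. mat_vec X A u \<in> U}"
  using assms
  by (auto simp: mat_subalgebra_def mats_closed mat_vec_one mat_vec_mult mat_vec_mat_add
      mat_vec_mat_scale vec.subspace_add vec.subspace_scale subset_iff simp del: plus_fun_apply)

context attenuated_space begin

section \<open>The cubic relations\<close>

abbreviation T where "T \<equiv> att_T scale h N M"
abbreviation Kmat where "Kmat \<equiv> att_K scale h N M"
abbreviation Lo where "Lo \<equiv> mat_vec P (lowering P)"
abbreviation Ra where "Ra \<equiv> mat_vec P (raising P)"
abbreviation Ko where "Ko \<equiv> mat_vec P Kmat"
abbreviation Fo where "Fo i \<equiv> mat_vec P (att_F scale h i)"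

definition Q :: complex where "Q = of_nat CARD('a)"

lemma Q_neq [simp]: "Q \<noteq> 0" "Q \<noteq> 1" "Q - 1 \<noteq> 0" "Q + 1 \<noteq> 0" "Q \<noteq> -1"
proof -
  have "Q \<noteq> of_nat 1" "Q \<noteq> of_nat 0"
    unfolding Q_def of_nat_eq_iff using q_ge_2 by simp_all
  moreover have "Q + 1 = of_nat (Suc CARD('a))"
    by (simp add: Q_def)
  then have "Q + 1 \<noteq> 0"
    by (simp only: of_nat_eq_0_iff nat.simps simp_thms)
  ultimately show "Q \<noteq> 0" "Q \<noteq> 1" "Q - 1 \<noteq> 0" "Q + 1 \<noteq> 0" "Q \<noteq> -1"
    by auto
qed

lemma Fo_eq: "Fo i v = (\<lambda>x. if x \<in> P \<and> dim x = i then v x else 0)"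
proof -
  have "att_F scale h i = (\<lambda>x y. if x = y \<and> (y \<in> P \<and> dim y = i) then 1 else 0)"
    by (auto simp: att_F_def att_level_def)
  then show ?thesis
    by (simp only: mat_vec_diag[OF finite_vector_sets]) (auto simp: fun_eq_iff)
qed

lemma Kmat_eq: "Kmat = (\<lambda>x y. if x = y \<and> y \<in> P then Q ^ (N + M - dim y) else 0)"
proof (intro ext)
  fix x y
  have sum_apply: "(\<Sum>i\<in>I. A i) x y = (\<Sum>i\<in>I. A i x y)" for I and A :: "nat \<Rightarrow> 'b set \<Rightarrow> 'b set \<Rightarrow> complex"
    by (induction I rule: infinite_finite_induct) auto
  have "Kmat x y = (\<Sum>i=0..N. Q ^ (N + M - i) * att_F scale h i x y)"
    unfolding att_K_def sum_apply by (simp add: mat_scale_def Q_def)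
  also have "\<dots> = (\<Sum>i=0..N. if i = dim y then (if x = y \<and> y \<in> P then Q ^ (N + M - dim y) else 0) else 0)"
    by (rule sum.cong) (auto simp: att_F_def att_level_def)
  also have "\<dots> = (if x = y \<and> y \<in> P then Q ^ (N + M - dim y) else 0)"
    using dim_P_le[of y] by auto
  finally show "Kmat x y = \<dots>" .
qed

lemma Ko_eq: "Ko v = (\<lambda>x. if x \<in> P then Q ^ (N + M - dim x) * v x else 0)"
  unfolding Kmat_eq by (subst mat_vec_diag) auto

definition Kinv :: "'b set \<Rightarrow> 'b set \<Rightarrow> complex" where
  "Kinv = (\<lambda>x y. if x = y \<and> y \<in> P then inverse (Q ^ (N + M - dim y)) else 0)"

lemma Kinv_vec: "mat_vec P Kinv v = (\<lambda>x. if x \<in> P then inverse (Q ^ (N + M - dim x)) * v x else 0)"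
  unfolding Kinv_def by (subst mat_vec_diag) auto

lemma mats_generators:
  "lowering P \<in> mats P" "raising P \<in> mats P" "Kmat \<in> mats P" "Kinv \<in> mats P" "att_F scale h i \<in> mats P"
  by (auto simp: mats_def lowering_def raising_def covered_by_def Kmat_eq Kinv_def att_F_def att_level_def)

lemma Kinv_Ko: "v \<in> vecs P \<Longrightarrow> mat_vec P Kinv (Ko v) = v" "v \<in> vecs P \<Longrightarrow> Ko (mat_vec P Kinv v) = v"
  by (auto simp: Ko_eq Kinv_vec vecs_def fun_eq_iff)

lemma mat_inv_K: "mat_inv P Kmat = Kinv"
proof (rule mat_inv_eq)
  show "mat_mult P Kmat Kinv = mat_one P"
    by (rule mats_eqI[of P])
      (simp_all add: mats_closed mats_generators mat_vec_mult Kinv_Ko mat_vec_one)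
  show "mat_mult P Kinv Kmat = mat_one P"
    by (rule mats_eqI[of P])
      (simp_all add: mats_closed mats_generators mat_vec_mult Kinv_Ko mat_vec_one)
qed (simp_all add: mats_generators)

lemma Lo_eq: "Lo v x = (\<Sum>y\<in>{y. x \<lessdot> y}. v y)"
proof -
  have "Lo v x = (\<Sum>y\<in>P. if x \<lessdot> y then v y else 0)"
    unfolding mat_vec_def lowering_def by (intro sum.cong) auto
  also have "\<dots> = (\<Sum>y\<in>{y\<in>P. x \<lessdot> y}. v y)"
    by (rule sum.inter_filter[symmetric]) simp
  also have "{y\<in>P. x \<lessdot> y} = {y. x \<lessdot> y}"
    by (auto simp: covered_by_def)
  finally show ?thesis .
qed

lemma Ra_eq: "Ra v x = (\<Sum>y\<in>{y. y \<lessdot> x}. v y)"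
proof -
  have "Ra v x = (\<Sum>y\<in>P. if y \<lessdot> x then v y else 0)"
    unfolding mat_vec_def raising_def by (intro sum.cong) auto
  also have "\<dots> = (\<Sum>y\<in>{y\<in>P. y \<lessdot> x}. v y)"
    by (rule sum.inter_filter[symmetric]) simp
  also have "{y\<in>P. y \<lessdot> x} = {y. y \<lessdot> x}"
    by (auto simp: covered_by_def)
  finally show ?thesis .
qed

lemma Fo_Lo: "Fo i (Lo v) = Lo (Fo (Suc i) v)"
proof (rule ext)
  fix x
  have "Lo (Fo (Suc i) v) x = (\<Sum>y\<in>{y. x \<lessdot> y}. if dim x = i then v y else 0)"
    unfolding Lo_eq Fo_eq by (rule sum.cong) (auto dest: coverD)
  also have "\<dots> = (if dim x = i then Lo v x else 0)"
    by (simp add: Lo_eq)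
  also have "\<dots> = Fo i (Lo v) x"
    by (auto simp: Fo_eq Lo_eq covered_by_def)
  finally show "Fo i (Lo v) x = Lo (Fo (Suc i) v) x" ..
qed

lemma Fo_Ra: "Fo (Suc i) (Ra v) = Ra (Fo i v)"
proof (rule ext)
  fix x
  have "Ra (Fo i v) x = (\<Sum>y\<in>{y. y \<lessdot> x}. if dim x = Suc i then v y else 0)"
    unfolding Ra_eq Fo_eq by (rule sum.cong) (auto dest: coverD)
  also have "\<dots> = (if dim x = Suc i then Ra v x else 0)"
    by (simp add: Ra_eq)
  also have "\<dots> = Fo (Suc i) (Ra v) x"
    by (auto simp: Fo_eq Ra_eq covered_by_def)
  finally show "Fo (Suc i) (Ra v) x = Ra (Fo i v) x" ..
qed

lemma Ko_Lo: "Ko (Lo v) = vec_scale Q (Lo (Ko v))"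
proof (rule ext)
  fix x
  have "Q * Lo (Ko v) x = (\<Sum>y\<in>{y. x \<lessdot> y}. Q ^ (N + M - dim x) * v y)"
    unfolding Lo_eq Ko_eq sum_distrib_left
  proof (rule sum.cong)
    fix y assume "y \<in> {y. x \<lessdot> y}"
    then have y: "y \<in> P" "dim y = Suc (dim x)" "dim y \<le> N"
      using dim_P_le by (auto dest: coverD)
    then have "N + M - dim x = Suc (N + M - dim y)" by simp
    then show "Q * (if y \<in> P then Q ^ (N + M - dim y) * v y else 0) = Q ^ (N + M - dim x) * v y"
      using y by simp
  qed simp
  also have "\<dots> = Ko (Lo v) x"
    by (auto simp: Ko_eq Lo_eq sum_distrib_left covered_by_def)
  finally show "Ko (Lo v) x = vec_scale Q (Lo (Ko v)) x"
    by (simp add: vec_scale_def)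
qed

lemma Ra_Ko: "Ra (Ko v) = vec_scale Q (Ko (Ra v))"
proof (rule ext)
  fix x
  have "Ra (Ko v) x = (\<Sum>y\<in>{y. y \<lessdot> x}. Q * (Q ^ (N + M - dim x) * v y))"
    unfolding Ra_eq Ko_eq
  proof (rule sum.cong)
    fix y assume "y \<in> {y. y \<lessdot> x}"
    then have y: "y \<in> P" "dim x = Suc (dim y)" "dim x \<le> N"
      using dim_P_le by (auto dest: coverD)
    then have "N + M - dim y = Suc (N + M - dim x)" by simp
    then show "(if y \<in> P then Q ^ (N + M - dim y) * v y else 0) = Q * (Q ^ (N + M - dim x) * v y)"
      using y by simp
  qed simp
  also have "\<dots> = Q * Ko (Ra v) x"
    by (auto simp: Ko_eq Ra_eq sum_distrib_left covered_by_def)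
  finally show "Ra (Ko v) x = vec_scale Q (Ko (Ra v)) x"
    by (simp add: vec_scale_def)
qed

section \<open>From walk counts to relations between matrices\<close>

lemma sum_walks:
  "(\<Sum>z\<in>P. (if A z then 1 else 0) * (\<Sum>w\<in>P. (if B z w then 1 else 0) * (if C w then 1 else 0))) =
    (of_nat (card {(z, w). z \<in> P \<and> w \<in> P \<and> A z \<and> B z w \<and> C w}) :: complex)"
proof -
  have "(\<Sum>z\<in>P. (if A z then 1 else 0) * (\<Sum>w\<in>P. (if B z w then 1 else 0) * (if C w then 1 else 0))) =
      (\<Sum>(z, w)\<in>P \<times> P. if A z \<and> B z w \<and> C w then 1 else 0 :: complex)"
    unfolding sum_distrib_left sum.cartesian_product by (rule sum.cong) (simp_all add: split_def)
  also have "\<dots> = (\<Sum>p\<in>P \<times> P. if p \<in> {(z, w). A z \<and> B z w \<and> C w} then 1 else 0 :: complex)"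
    by (rule sum.cong) (simp_all add: split_def)
  also have "\<dots> = of_nat (card (P \<times> P \<inter> {(z, w). A z \<and> B z w \<and> C w}))"
    by (subst sum.inter_restrict[symmetric]) auto
  also have "P \<times> P \<inter> {(z, w). A z \<and> B z w \<and> C w} = {(z, w). z \<in> P \<and> w \<in> P \<and> A z \<and> B z w \<and> C w}"
    by auto
  finally show ?thesis .
qed

text \<open>\<open>raising P\<close> is the transpose of \<open>lowering P\<close>. Reversed
  products, read at the transposed entry, therefore count the same walks.\<close>

lemma walk_matrices:
  defines "LL \<equiv> lowering P" and "RR \<equiv> raising P"
  shows "mat_mult P LL (mat_mult P RR LL) x y =
      of_nat (card {(z, w). x \<lessdot> z \<and> w \<lessdot> z \<and> w \<lessdot> y})"
    and "mat_mult P RR (mat_mult P LL LL) x y =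
      of_nat (card {(u, z). u \<lessdot> x \<and> u \<lessdot> z \<and> z \<lessdot> y})"
    and "mat_mult P LL (mat_mult P LL RR) x y =
      of_nat (card {(b, a). y \<lessdot> b \<and> x \<lessdot> a \<and> a \<lessdot> b})"
    and "mat_mult P RR (mat_mult P LL RR) y x =
      of_nat (card {(z, w). x \<lessdot> z \<and> w \<lessdot> z \<and> w \<lessdot> y})"
    and "mat_mult P RR (mat_mult P RR LL) y x =
      of_nat (card {(u, z). u \<lessdot> x \<and> u \<lessdot> z \<and> z \<lessdot> y})"
    and "mat_mult P LL (mat_mult P RR RR) y x =
      of_nat (card {(b, a). y \<lessdot> b \<and> x \<lessdot> a \<and> a \<lessdot> b})"
proof -
  have swap: "card {(a, b). S a b} = card {(b, a). S a b}" for S :: "'b set \<Rightarrow> 'b set \<Rightarrow> bool"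
    by (rule bij_betw_same_card[of prod.swap]) (auto intro!: bij_betwI[where g = prod.swap])
  note defs = LL_def RR_def mat_mult_def lowering_def raising_def sum_walks
  show "mat_mult P LL (mat_mult P RR LL) x y = of_nat (card {(z, w). x \<lessdot> z \<and> w \<lessdot> z \<and> w \<lessdot> y})"
    unfolding defs by (intro arg_cong[of _ _ of_nat] arg_cong[of _ _ card]) (auto simp: covered_by_def)
  show "mat_mult P RR (mat_mult P LL LL) x y = of_nat (card {(u, z). u \<lessdot> x \<and> u \<lessdot> z \<and> z \<lessdot> y})"
    unfolding defs by (intro arg_cong[of _ _ of_nat] arg_cong[of _ _ card]) (auto simp: covered_by_def)
  show "mat_mult P LL (mat_mult P LL RR) x y = of_nat (card {(b, a). y \<lessdot> b \<and> x \<lessdot> a \<and> a \<lessdot> b})"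
    unfolding defs by (subst swap, intro arg_cong[of _ _ of_nat] arg_cong[of _ _ card]) (auto simp: covered_by_def)
  show "mat_mult P RR (mat_mult P LL RR) y x = of_nat (card {(z, w). x \<lessdot> z \<and> w \<lessdot> z \<and> w \<lessdot> y})"
    unfolding defs by (subst swap, intro arg_cong[of _ _ of_nat] arg_cong[of _ _ card]) (auto simp: covered_by_def)
  show "mat_mult P RR (mat_mult P RR LL) y x = of_nat (card {(u, z). u \<lessdot> x \<and> u \<lessdot> z \<and> z \<lessdot> y})"
    unfolding defs by (subst swap, intro arg_cong[of _ _ of_nat] arg_cong[of _ _ card]) (auto simp: covered_by_def)
  show "mat_mult P LL (mat_mult P RR RR) y x = of_nat (card {(b, a). y \<lessdot> b \<and> x \<lessdot> a \<and> a \<lessdot> b})"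
    unfolding defs by (intro arg_cong[of _ _ of_nat] arg_cong[of _ _ card]) (auto simp: covered_by_def)
qed

text \<open>The last summand is q + 1 times the (x, y) entry of \<open>L K\<close>, which is also
  the (y, x) entry of \<open>K R\<close>, so a single count yields both cubic relations.\<close>

lemma walk_count:
  "(Q + 1) * of_nat (card {(z, w). x \<lessdot> z \<and> w \<lessdot> z \<and> w \<lessdot> y}) =
    Q * of_nat (card {(u, z). u \<lessdot> x \<and> u \<lessdot> z \<and> z \<lessdot> y}) +
    of_nat (card {(b, a). y \<lessdot> b \<and> x \<lessdot> a \<and> a \<lessdot> b}) +
    (Q + 1) * (if x \<lessdot> y then Q ^ (N + M - dim y) else 0)"
proof (cases "x \<lessdot> y")
  case True
  show ?thesis
    using arg_cong[OF walk_count_covers[OF True], of "of_nat :: nat \<Rightarrow> complex"]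
    by (simp only: True if_True of_nat_add of_nat_mult of_nat_1 of_nat_power Q_def)
next
  case False
  show ?thesis
    using arg_cong[OF walk_count_not_covers[OF False], of "of_nat :: nat \<Rightarrow> complex"]
    by (simp only: False if_False of_nat_add of_nat_mult of_nat_1 Q_def mult_zero_right add_0_right)
qed

lemma mult_Kmat:
  "mat_mult P (lowering P) Kmat x y = (if x \<lessdot> y then Q ^ (N + M - dim y) else 0)"
  "mat_mult P Kmat (raising P) y x = (if x \<lessdot> y then Q ^ (N + M - dim y) else 0)"
proof -
  have "mat_mult P (lowering P) Kmat x y = (\<Sum>z\<in>P. if z = y then (if x \<lessdot> y then Q ^ (N + M - dim y) else 0) else 0)"
    unfolding mat_mult_def Kmat_eq lowering_def by (rule sum.cong) auto
  then show "mat_mult P (lowering P) Kmat x y = (if x \<lessdot> y then Q ^ (N + M - dim y) else 0)"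
    by (simp add: covered_by_def)
  have "mat_mult P Kmat (raising P) y x = (\<Sum>z\<in>P. if z = y then (if x \<lessdot> y then Q ^ (N + M - dim y) else 0) else 0)"
    unfolding mat_mult_def Kmat_eq raising_def by (rule sum.cong) auto
  then show "mat_mult P Kmat (raising P) y x = (if x \<lessdot> y then Q ^ (N + M - dim y) else 0)"
    by (simp add: covered_by_def)
qed

lemma cubic_lowering:
  "vec_scale (Q + 1) (Lo (Ra (Lo v))) =
    vec_scale Q (Ra (Lo (Lo v))) + Lo (Lo (Ra v)) + vec_scale (Q + 1) (Lo (Ko v))"
proof -
  let ?L = "lowering P" and ?R = "raising P"
  have "mat_scale (Q + 1) (mat_mult P ?L (mat_mult P ?R ?L)) =
      mat_scale Q (mat_mult P ?R (mat_mult P ?L ?L)) + mat_mult P ?L (mat_mult P ?L ?R) +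
      mat_scale (Q + 1) (mat_mult P ?L Kmat)"
    by (simp add: fun_eq_iff mat_scale_def walk_matrices mult_Kmat walk_count)
  then show ?thesis
    by (metis mat_vec_mult mat_vec_mat_scale mat_vec_mat_add)
qed

lemma cubic_raising:
  "vec_scale (Q + 1) (Ra (Lo (Ra v))) =
    vec_scale Q (Ra (Ra (Lo v))) + Lo (Ra (Ra v)) + vec_scale (Q + 1) (Ko (Ra v))"
proof -
  let ?L = "lowering P" and ?R = "raising P"
  have "mat_scale (Q + 1) (mat_mult P ?R (mat_mult P ?L ?R)) =
      mat_scale Q (mat_mult P ?R (mat_mult P ?R ?L)) + mat_mult P ?L (mat_mult P ?R ?R) +
      mat_scale (Q + 1) (mat_mult P Kmat ?R)"
    by (simp add: fun_eq_iff mat_scale_def walk_matrices mult_Kmat walk_count)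
  then show ?thesis
    by (metis mat_vec_mult mat_vec_mat_scale mat_vec_mat_add)
qed

section \<open>The operator Z and what it commutes with\<close>

definition Cas :: "'b set \<Rightarrow> 'b set \<Rightarrow> complex" where
  "Cas = mat_scale (Q + 1) Kmat - mat_scale (Q - 1)
    (mat_mult P (lowering P) (raising P) - mat_scale Q (mat_mult P (raising P) (lowering P)))"

abbreviation Zo where "Zo \<equiv> mat_vec P Cas"

lemma mats_Cas: "Cas \<in> mats P"
  unfolding Cas_def by (intro mats_closed mats_generators)

lemma Zo_eq: "Zo v = vec_scale (Q + 1) (Ko v) - vec_scale (Q - 1) (Lo (Ra v) - vec_scale Q (Ra (Lo v)))"
  by (simp only: Cas_def mat_vec_mat_diff mat_vec_mat_scale mat_vec_mult)

text \<open>Because K L = q L K, the terms in \<open>K\<close> contribute (q^2 - 1) L K to Z L - L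
  Z, and the whole commutator is q - 1 times the difference of the two sides of the cubic
  relation.\<close>

lemma Zo_Lo: "Zo (Lo v) = Lo (Zo v)"
proof (rule ext)
  fix x
  have "(Q + 1) * Lo (Ra (Lo v)) x = Q * Ra (Lo (Lo v)) x + Lo (Lo (Ra v)) x + (Q + 1) * Lo (Ko v) x"
    using fun_cong[OF cubic_lowering, of v x] by (simp add: vec_scale_def)
  then have "(Q - 1) * ((Q + 1) * Lo (Ra (Lo v)) x) =
      (Q - 1) * (Q * Ra (Lo (Lo v)) x + Lo (Lo (Ra v)) x + (Q + 1) * Lo (Ko v) x)"
    by simp
  then show "Zo (Lo v) x = Lo (Zo v) x"
    unfolding Zo_eq mat_vec_diff mat_vec_scale Ko_Lo
    by (simp add: vec_scale_def algebra_simps)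
qed

lemma Zo_Ra: "Zo (Ra v) = Ra (Zo v)"
proof (rule ext)
  fix x
  have "(Q + 1) * Ra (Lo (Ra v)) x = Q * Ra (Ra (Lo v)) x + Lo (Ra (Ra v)) x + (Q + 1) * Ko (Ra v) x"
    using fun_cong[OF cubic_raising, of v x] by (simp add: vec_scale_def)
  then have "(Q - 1) * ((Q + 1) * Ra (Lo (Ra v)) x) =
      (Q - 1) * (Q * Ra (Ra (Lo v)) x + Lo (Ra (Ra v)) x + (Q + 1) * Ko (Ra v) x)"
    by simp
  then show "Zo (Ra v) x = Ra (Zo v) x"
    unfolding Zo_eq mat_vec_diff mat_vec_scale Ra_Ko
    by (simp add: vec_scale_def algebra_simps)
qed

lemma Fo_Ko: "Fo i (Ko v) = vec_scale (Q ^ (N + M - i)) (Fo i v)"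
  by (auto simp: Fo_eq Ko_eq vec_scale_def fun_eq_iff)

lemma Ko_Fo: "Ko (Fo i v) = vec_scale (Q ^ (N + M - i)) (Fo i v)"
  by (auto simp: Fo_eq Ko_eq vec_scale_def fun_eq_iff)

lemma Fo_0_Lo: "Lo (Fo 0 v) = 0"
  unfolding Lo_eq fun_eq_iff Fo_eq
  by (auto dest: coverD(4) intro!: sum.neutral simp del: dim_eq_0)

lemma Fo_0_Ra: "Fo 0 (Ra v) = 0"
  unfolding Ra_eq fun_eq_iff Fo_eq
  by (auto dest: coverD(4) intro!: sum.neutral simp del: dim_eq_0)

lemma Zo_Fo: "Zo (Fo i v) = Fo i (Zo v)"
proof -
  have "Ra (Lo (Fo i v)) = Fo i (Ra (Lo v))"
    \<comment> \<open>At level 0 both sides vanish: \<open>L\<close> kills that level and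
      \<open>R\<close> never reaches it.\<close>
    by (cases i) (simp_all add: Fo_0_Lo Fo_0_Ra Fo_Ra Fo_Lo mat_vec_zero)
  moreover have "Lo (Ra (Fo i v)) = Fo i (Lo (Ra v))"
    by (simp add: Fo_Ra Fo_Lo)
  ultimately show ?thesis
    by (simp only: Zo_eq mat_vec_diff mat_vec_scale Ko_Fo Fo_Ko)
qed

section \<open>Submodules as graded subspaces\<close>

text \<open>Stands in for invariance under \<open>T\<close>, which is only given as a hull; the
  level projections replace \<open>K\<close> and its inverse.\<close>

definition graded :: "('b set \<Rightarrow> complex) set \<Rightarrow> bool" where
  "graded U \<longleftrightarrow> U \<subseteq> vecs P \<and> vec.subspace U \<and>
    (\<forall>u\<in>U. Lo u \<in> U \<and> Ra u \<in> U \<and> (\<forall>i. Fo i u \<in> U))"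

lemma gradedD:
  assumes "graded U"
  shows "U \<subseteq> vecs P" "vec.subspace U" "u \<in> U \<Longrightarrow> Lo u \<in> U" "u \<in> U \<Longrightarrow> Ra u \<in> U" "u \<in> U \<Longrightarrow> Fo i u \<in> U"
  using assms by (auto simp: graded_def)

lemma Fo_Fo: "Fo i (Fo j v) = (if i = j then Fo i v else 0)"
  by (auto simp: Fo_eq fun_eq_iff)

lemma Fo_large: "N < i \<Longrightarrow> Fo i v = 0"
  using dim_P_le by (fastforce simp: Fo_eq fun_eq_iff)

lemma sum_fun_apply: "(\<Sum>i\<in>I. f i) x = (\<Sum>i\<in>I. f i x :: complex)"
  by (induction I rule: infinite_finite_induct) auto

lemma diag_level_expansion:
  "(\<lambda>x. if x \<in> P then g (dim x) * v x else 0) = (\<Sum>i\<le>N. vec_scale (g i) (Fo i v))"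
proof (rule ext)
  fix x
  have "(\<Sum>i\<le>N. vec_scale (g i) (Fo i v)) x = (\<Sum>i\<le>N. if i = dim x then (if x \<in> P then g (dim x) * v x else 0) else 0)"
    unfolding sum_fun_apply by (rule sum.cong) (auto simp: vec_scale_def Fo_eq)
  also have "\<dots> = (if x \<in> P then g (dim x) * v x else 0)"
    using dim_P_le[of x] by simp
  finally show "(if x \<in> P then g (dim x) * v x else 0) = (\<Sum>i\<le>N. vec_scale (g i) (Fo i v)) x" ..
qed

lemma Fo_expansion: "v \<in> vecs P \<Longrightarrow> v = (\<Sum>i\<le>N. Fo i v)"
proof -
  assume "v \<in> vecs P"
  then have "v = (\<lambda>x. if x \<in> P then 1 * v x else 0)"
    by (auto simp: vecs_def fun_eq_iff)
  also have "\<dots> = (\<Sum>i\<le>N. vec_scale 1 (Fo i v))"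
    by (rule diag_level_expansion)
  finally show ?thesis by (simp only: vec.scale_one)
qed

lemma Ko_expansion: "Ko v = (\<Sum>i\<le>N. vec_scale (Q ^ (N + M - i)) (Fo i v))"
  unfolding Ko_eq by (rule diag_level_expansion)

lemma Kinv_expansion: "mat_vec P Kinv v = (\<Sum>i\<le>N. vec_scale (inverse (Q ^ (N + M - i))) (Fo i v))"
  unfolding Kinv_vec by (rule diag_level_expansion)

lemma Q_power_inject: "Q ^ a = Q ^ b \<longleftrightarrow> a = b"
proof -
  have "Q ^ a = Q ^ b \<longleftrightarrow> CARD('a) ^ a = CARD('a) ^ b"
    unfolding Q_def of_nat_power[symmetric] of_nat_eq_iff ..
  then show ?thesis
    using q_ge_2 by simp
qed

text \<open>\<open>K\<close> has different eigenvalues on different levels, so an invariant subspace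
  contains the level components of its members. The induction runs over a finite set of levels that
  carries u and removes one level at a time.\<close>

lemma Fo_closed_if_Ko_closed:
  assumes U: "U \<subseteq> vecs P" "vec.subspace U" and K: "\<And>u. u \<in> U \<Longrightarrow> Ko u \<in> U" and u: "u \<in> U"
  shows "Fo i u \<in> U"
proof -
  have "\<forall>u\<in>U. (\<forall>i. i \<notin> S \<longrightarrow> Fo i u = 0) \<longrightarrow> (\<forall>i. Fo i u \<in> U)" if "finite S" for S
    using that
  proof (induction S rule: finite_induct)
    case empty
    then show ?case using vec.subspace_0[OF U(2)] by (metis empty_iff)
  next
    case (insert m S)
    show ?case
    proof (intro ballI impI)
      fix u assume u: "u \<in> U" "\<forall>i. i \<notin> insert m S \<longrightarrow> Fo i u = 0"
      \<comment> \<open>This kills the component in level m and multiplies the others by scalars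
        that are nonzero for levels up to N.\<close>
      define u' where "u' = Ko u - vec_scale (Q ^ (N + M - m)) u"
      have "u' \<in> U"
        using u K U by (auto simp: u'_def intro!: vec.subspace_diff vec.subspace_scale)
      have Fu': "Fo i u' = vec_scale (Q ^ (N + M - i) - Q ^ (N + M - m)) (Fo i u)" for i
        by (simp only: u'_def mat_vec_diff mat_vec_scale Fo_Ko vec.scale_left_diff_distrib)
      have "Fo i u' = 0" if "i \<notin> S" for i
        using that u(2) by (cases "i = m") (simp_all add: Fu')
      then have F'U: "Fo i u' \<in> U" for i
        using insert.IH \<open>u' \<in> U\<close> by blast
      \<comment> \<open>The exponents N + M - i truncate, so eigenvalues are compared only up to
        level N; higher components are 0 anyway.\<close>
      have ne: "Fo i u \<in> U" if "i \<noteq> m" "m \<le> N" for i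
      proof (cases "i \<le> N")
        case True
        then have "Q ^ (N + M - i) - Q ^ (N + M - m) \<noteq> 0" (is "?c \<noteq> 0")
          using that by (auto simp: Q_power_inject)
        moreover have "vec_scale (inverse ?c) (Fo i u') \<in> U"
          using F'U U(2) by (intro vec.subspace_scale)
        ultimately show ?thesis
          by (simp add: Fu')
      next
        case False
        then show ?thesis
          using vec.subspace_0[OF U(2)] by (simp add: Fo_large)
      qed
      show "\<forall>i. Fo i u \<in> U"
      proof (cases "m \<le> N")
        case True
        have "u = Fo m u + (\<Sum>i\<in>{..N} - {m}. Fo i u)"
          using Fo_expansion[of u] u(1) U(1) True by (subst sum.remove[symmetric]) auto
        then have "Fo m u = u - (\<Sum>i\<in>{..N} - {m}. Fo i u)"
          by (metis add_diff_cancel_right')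
        also have "\<dots> \<in> U"
          using u(1) ne True U(2) by (intro vec.subspace_diff vec.subspace_sum) auto
        finally show ?thesis
          using ne True by metis
      next
        case False
        then have "\<forall>i. i \<notin> S \<longrightarrow> Fo i u = 0"
          using u(2) by (metis Fo_large insertE not_le)
        then show ?thesis using insert.IH u(1) by blast
      qed
    qed
  qed
  from this[of "{..N}"] u show ?thesis
    by (simp add: Fo_large)
qed

lemma generators_in_T: "raising P \<in> T" "lowering P \<in> T" "Kmat \<in> T"
  by (auto simp: att_T_def intro!: hull_inc)

lemma T_minimal:
  assumes "mat_subalgebra P S" "raising P \<in> S" "lowering P \<in> S" "Kmat \<in> S" "Kinv \<in> S"
  shows "T \<subseteq> S"
  unfolding att_T_def mat_inv_K using assms by (intro hull_minimal) auto

lemma T_mats: "T \<subseteq> mats P"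
  by (intro T_minimal mat_subalgebra_mats mats_generators)

text \<open>One direction extracts the levels from \<open>K\<close>. For the other, the matrices
  preserving U form a subalgebra, and \<open>K\<close> and its inverse lie in it as linear
  combinations of the level projections.\<close>

lemma submodule_iff_graded: "submodule_of P T U \<longleftrightarrow> graded U"
proof
  assume U: "submodule_of P T U"
  then have "Fo i u \<in> U" if "u \<in> U" for i u
    using generators_in_T that by (intro Fo_closed_if_Ko_closed) (auto simp: submodule_of_def)
  then show "graded U"
    using U generators_in_T by (auto simp: submodule_of_def graded_def)
next
  assume U: "graded U"
  note U = gradedD[OF U]
  let ?S = "{A \<in> mats P. \<forall>u\<in>U. mat_vec P A u \<in> U}"
  have "T \<subseteq> ?S"
  proof (rule T_minimal)
    show "mat_subalgebra P ?S"
      using U by (intro mat_subalgebra_stabilizer) auto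
    show "Kmat \<in> ?S"
      using U by (auto simp: mats_generators Ko_expansion intro!: vec.subspace_sum vec.subspace_scale)
    show "Kinv \<in> ?S"
      using U by (auto simp: mats_generators Kinv_expansion intro!: vec.subspace_sum vec.subspace_scale)
  qed (use U in \<open>auto simp: mats_generators\<close>)
  then show "submodule_of P T U"
    using U by (auto simp: submodule_of_def)
qed

abbreviation irred where "irred W \<equiv> irreducible_submodule_of P T W"

lemma irred_iff: "irred W \<longleftrightarrow> graded W \<and> W \<noteq> {0} \<and> (\<forall>U. graded U \<and> U \<subseteq> W \<longrightarrow> U = {0} \<or> U = W)"
  by (simp add: irreducible_submodule_of_def submodule_iff_graded)

section \<open>The structure of irreducible modules\<close>

text \<open>The scalar by which \<open>L\<close> takes the i-th string vector to its predecessor.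
  For i > 0 it is (q^i - 1)(cas_value r (i-1) - cas_value r d) / (q - 1)^2, the form delivered by
  \<open>Lo_Ra_pow\<close>; it vanishes at i = 0 and i = d + 1.\<close>

definition lower_coeff :: "nat \<Rightarrow> nat \<Rightarrow> nat \<Rightarrow> complex" where
  "lower_coeff r d i = Q * Q ^ (N + M - r) * (Q ^ i - 1) * (1 / Q ^ i - 1 / Q ^ Suc d) / (Q - 1)\<^sup>2"

text \<open>A quotient replaces the power q^(n-r-d), so that no truncation occurs when d is large:
  \<open>Lo_Ra_pow\<close> uses the value at every index.\<close>

definition cas_value :: "nat \<Rightarrow> nat \<Rightarrow> complex" where
  "cas_value r d = Q * Q ^ (N + M - r) * (1 + 1 / Q ^ Suc d)"

lemma Fo_Ra_pow: "Fo r v = v \<Longrightarrow> Fo (r + i) ((Ra ^^ i) v) = (Ra ^^ i) v"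
  by (induction i) (simp_all add: Fo_Ra)

lemma Ko_Ra_pow:
  assumes "Fo r v = v"
  shows "Ko ((Ra ^^ i) v) = vec_scale (Q ^ (N + M - r) / Q ^ i) ((Ra ^^ i) v)"
proof -
  have *: "Ko ((Ra ^^ i) v) = vec_scale (Q ^ (N + M - (r + i))) ((Ra ^^ i) v)"
    using Ko_Fo[of "r + i" "(Ra ^^ i) v"] Fo_Ra_pow[OF assms] by simp
  show ?thesis
  proof (cases "r + i \<le> N")
    case True
    then have "Q ^ (N + M - r) = Q ^ (N + M - (r + i)) * Q ^ i"
      by (simp flip: power_add)
    then show ?thesis using * by simp
  next
    \<comment> \<open>Above level N the vector itself is 0, which makes up for the truncated
      exponent.\<close>
    case False
    then have "(Ra ^^ i) v = 0"
      using Fo_Ra_pow[OF assms, of i] Fo_large[of "r + i"] by simp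
    then show ?thesis by (simp add: mat_vec_zero)
  qed
qed

text \<open>Solving the definition of Z for \<open>L R\<close> expresses L R^(i+1) v through R L R^i
  v, \<open>K\<close> and Z, and Z commutes with \<open>R\<close>. Z is kept as an operator because
  this formula is what later proves v to be an eigenvector of it.\<close>

lemma Lo_Ra_pow:
  assumes r: "Fo r v = v" and L: "Lo v = 0"
  shows "vec_scale ((Q - 1)\<^sup>2) (Lo ((Ra ^^ Suc i) v)) =
    vec_scale (Q ^ Suc i - 1) (vec_scale (cas_value r i) ((Ra ^^ i) v) - Zo ((Ra ^^ i) v))"
proof (induction i)
  case 0
  show ?case
  proof (rule ext)
    fix x
    have "Zo v x = (Q + 1) * (Q ^ (N + M - r) * v x) - (Q - 1) * Lo (Ra v) x"
      using Ko_Ra_pow[OF r, of 0] by (simp add: Zo_eq vec_scale_def L mat_vec_zero)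
    then have "(Q - 1) * Lo (Ra v) x = (Q + 1) * Q ^ (N + M - r) * v x - Zo v x"
      by simp
    moreover have "cas_value r 0 = (Q + 1) * Q ^ (N + M - r)"
      by (simp add: cas_value_def field_simps)
    ultimately show "vec_scale ((Q - 1)\<^sup>2) (Lo ((Ra ^^ Suc 0) v)) x =
        vec_scale (Q ^ Suc 0 - 1) (vec_scale (cas_value r 0) ((Ra ^^ 0) v) - Zo ((Ra ^^ 0) v)) x"
      by (simp add: vec_scale_def power2_eq_square mult.assoc)
  qed
next
  case (Suc i)
  define u where "u = (Ra ^^ Suc i) v"
  define k where "k = Q ^ (N + M - r)"
  define p where "p = Q ^ i"
  have p: "p \<noteq> 0" by (simp add: p_def)
  have IH: "vec_scale ((Q - 1)\<^sup>2) (Ra (Lo u)) = vec_scale (Q ^ Suc i - 1) (vec_scale (cas_value r i) u - Zo u)"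
    using arg_cong[OF Suc, of Ra]
    by (simp only: mat_vec_scale mat_vec_diff Zo_Ra u_def funpow.simps o_apply)
  show ?case
  proof (rule ext)
    fix x
    have 1: "(Q - 1)\<^sup>2 * Ra (Lo u) x = (Q * p - 1) * (Q * k * (1 + 1 / (Q * p)) * u x - Zo u x)"
      using fun_cong[OF IH, of x] by (simp add: vec_scale_def cas_value_def k_def p_def)
    have "Zo u x = (Q + 1) * (k / (Q * p) * u x) - (Q - 1) * (Lo (Ra u) x - Q * Ra (Lo u) x)"
      using Ko_Ra_pow[OF r, of "Suc i"] by (simp add: Zo_eq vec_scale_def u_def k_def p_def)
    \<comment> \<open>Read c = q - 1, g = q, X = L R u and Y = R L u at the point x: this is the
      definition of Z solved for X, multiplied by c to reach the squared factor.\<close>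
    moreover have "c\<^sup>2 * X = c * (a - z) + g * (c\<^sup>2 * Y)" if "z = a - c * (X - g * Y)" for a c g z X Y :: complex
      unfolding that by (simp add: power2_eq_square algebra_simps)
    ultimately have "(Q - 1)\<^sup>2 * Lo (Ra u) x =
        (Q - 1) * ((Q + 1) * (k / (Q * p) * u x) - Zo u x) + Q * ((Q - 1)\<^sup>2 * Ra (Lo u) x)"
      by blast
    also have "\<dots> = (Q * (Q * p) - 1) * (Q * k * (1 + 1 / (Q * (Q * p))) * u x - Zo u x)"
      unfolding 1 using p by (simp add: field_simps)
    finally show "vec_scale ((Q - 1)\<^sup>2) (Lo ((Ra ^^ Suc (Suc i)) v)) x =
        vec_scale (Q ^ Suc (Suc i) - 1) (vec_scale (cas_value r (Suc i)) ((Ra ^^ Suc i) v) - Zo ((Ra ^^ Suc i) v)) x"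
      by (simp add: vec_scale_def cas_value_def flip: u_def k_def p_def)
         (simp add: u_def)
  qed
qed

text \<open>The family is indexed by all naturals and is zero beyond d, so that raising has no
  boundary case.\<close>

definition is_string :: "nat \<Rightarrow> nat \<Rightarrow> (nat \<Rightarrow> 'b set \<Rightarrow> complex) \<Rightarrow> bool" where
  "is_string r d w \<longleftrightarrow> (\<forall>i. Fo (r + i) (w i) = w i) \<and> (\<forall>i. Ra (w i) = w (Suc i)) \<and> Lo (w 0) = 0 \<and>
    (\<forall>i. Lo (w (Suc i)) = vec_scale (lower_coeff r d (Suc i)) (w i)) \<and>
    (\<forall>i. w i = 0 \<longleftrightarrow> d < i) \<and> (\<forall>i. Zo (w i) = vec_scale (cas_value r d) (w i))"

lemma att_support_eq:
  assumes "graded W"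
  shows "att_support scale h N W = {i \<in> {0..N}. \<exists>u\<in>W. Fo i u \<noteq> 0}"
proof -
  have "Fo i ` W \<noteq> {0} \<longleftrightarrow> (\<exists>u\<in>W. Fo i u \<noteq> 0)" for i
    using vec.subspace_0[OF gradedD(2)[OF assms]] by force
  then show ?thesis
    by (simp add: att_support_def)
qed

text \<open>
  Among the nonzero lowest-level vectors \<open>v\<close> of \<open>W\<close> pick one with the shortest string
  \<open>v, R v, R\<^sup>2 v, \<dots>\<close>. If its last nonzero term is \<open>R\<^sup>d v\<close>, then \<open>0 = L R\<^sup>d\<^sup>+\<^sup>1 v\<close> is a nonzero multiple of
  \<open>R\<^sup>d\<close> applied to \<open>\<zeta> v - Z v\<close> with \<open>\<zeta> = cas_value r d\<close>, so minimality forces \<open>Z v = \<zeta> v\<close>.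
\<close>

lemma irreducible_string:
  assumes W: "irred W"
  obtains w where "is_string (endpoint scale h N W) (diameter scale h N W) w"
    and "W = vec.span (range w)"
    and "endpoint scale h N W + diameter scale h N W \<le> N"
proof -
  have gr: "graded W" and W0: "W \<noteq> {0}"
    and min: "\<And>U. graded U \<Longrightarrow> U \<subseteq> W \<Longrightarrow> U = {0} \<or> U = W"
    using W by (auto simp: irred_iff)
  note gW = gradedD[OF gr]
  define S where "S = att_support scale h N W"
  define r where "r = Min S"
  have S: "S = {i \<in> {0..N}. \<exists>u\<in>W. Fo i u \<noteq> 0}"
    unfolding S_def by (rule att_support_eq[OF gr])
  obtain u0 where u0: "u0 \<in> W" "u0 \<noteq> 0"
    using W0 vec.subspace_0[OF gW(2)] by auto
  have "S \<noteq> {}"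
  proof
    assume "S = {}"
    then have "(\<Sum>i\<le>N. Fo i u0) = 0"
      using u0 by (intro sum.neutral) (auto simp: S)
    then show False
      using Fo_expansion[of u0] u0 gW(1) by auto
  qed
  then have rS: "r \<in> S"
    unfolding r_def by (intro Min_in) (simp_all add: S)
  have r_le: "r \<le> i" if "i \<in> S" for i
    unfolding r_def using that by (intro Min_le) (simp_all add: S)
  define low where "low v \<longleftrightarrow> v \<in> W \<and> v \<noteq> 0 \<and> Fo r v = v \<and> Lo v = 0" for v
  obtain v0 where "low v0"
  proof -
    obtain u where u: "u \<in> W" "Fo r u \<noteq> 0"
      using rS by (auto simp: S)
    \<comment> \<open>By minimality of r, level r - 1 of W is zero; for r = 0 there is no level
      below.\<close>
    have "Lo (Fo r u) = 0"
    proof (cases r)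
      case 0
      then show ?thesis by (simp only: Fo_0_Lo)
    next
      case (Suc m)
      then have "m \<notin> S" "m \<le> N"
        using r_le[of m] rS by (auto simp: S)
      then have "Fo m (Lo u) = 0"
        using gW(3)[OF u(1)] by (auto simp: S)
      then show ?thesis by (simp only: Suc Fo_Lo)
    qed
    then have "low (Fo r u)"
      using u gW(5) by (simp add: low_def Fo_Fo)
    then show thesis by (rule that)
  qed
  define short where "short n \<longleftrightarrow> (\<exists>v. low v \<and> (Ra ^^ Suc n) v = 0)" for n
  \<comment> \<open>N + 1 raisings lead above the top level, so strings terminate and a least length
    exists.\<close>
  have "Fo (r + Suc N) ((Ra ^^ Suc N) v0) = (Ra ^^ Suc N) v0"
    using \<open>low v0\<close> by (intro Fo_Ra_pow) (simp add: low_def)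
  then have "short N"
    using \<open>low v0\<close> Fo_large[of "r + Suc N" "(Ra ^^ Suc N) v0"] by (auto simp: short_def)
  define d where "d = (LEAST n. short n)"
  have "short d"
    unfolding d_def using \<open>short N\<close> by (rule LeastI)
  then obtain v where v: "low v" "(Ra ^^ Suc d) v = 0"
    by (auto simp: short_def)
  have min_d: "(Ra ^^ i) u \<noteq> 0" if "low u" "i \<le> d" for u i
  proof (cases i)
    case 0
    then show ?thesis using that by (simp add: low_def)
  next
    case (Suc m)
    then show ?thesis
      using not_less_Least[of m short] that by (auto simp: short_def d_def)
  qed
  have v': "v \<in> W" "Fo r v = v" "Lo v = 0" "v \<noteq> 0"
    using v by (auto simp: low_def)
  have Zo_W: "Zo u \<in> W" if "u \<in> W" for u
    unfolding Zo_eq Ko_expansion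
    using that gW by (intro vec.subspace_diff vec.subspace_scale vec.subspace_sum) auto
  have Zo_pow: "Zo ((Ra ^^ i) u) = (Ra ^^ i) (Zo u)" for i u
    by (induction i) (simp_all add: Zo_Ra)
  have pow_scale: "(Ra ^^ i) (vec_scale c u) = vec_scale c ((Ra ^^ i) u)" for i c u
    by (induction i) (simp_all add: mat_vec_scale)
  have pow_diff: "(Ra ^^ i) (u - u') = (Ra ^^ i) u - (Ra ^^ i) u'" for i u u'
    by (induction i) (simp_all only: funpow.simps id_apply o_apply mat_vec_diff)
  define z where "z = vec_scale (cas_value r d) v - Zo v"
  have "z = 0"
  proof (rule ccontr)
    assume "z \<noteq> 0"
    moreover have "z \<in> W"
      using v'(1) gW(2) Zo_W by (auto simp: z_def intro!: vec.subspace_diff vec.subspace_scale)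
    moreover have "Fo r z = z"
      unfolding z_def by (simp only: mat_vec_diff mat_vec_scale v'(2) flip: Zo_Fo)
    moreover have "Lo z = 0"
      unfolding z_def by (simp only: mat_vec_diff mat_vec_scale v'(3) mat_vec_zero vec.scale_zero_right diff_self flip: Zo_Lo)
    ultimately have "(Ra ^^ d) z \<noteq> 0"
      using min_d[of z d] by (simp add: low_def)
    moreover have "vec_scale (Q ^ Suc d - 1) ((Ra ^^ d) z) = 0"
      using Lo_Ra_pow[OF v'(2,3), of d] v(2)
      by (simp only: z_def pow_diff pow_scale Zo_pow mat_vec_zero vec.scale_zero_right)
    moreover have "Q ^ Suc d - 1 \<noteq> 0"
      using Q_power_inject[of "Suc d" 0] by simp
    ultimately show False
      by (simp del: power_Suc)
  qed
  then have Zv: "Zo v = vec_scale (cas_value r d) v"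
    by (simp only: z_def eq_iff_diff_eq_0[symmetric])
  define w where "w i = (Ra ^^ i) v" for i
  have wW: "w i \<in> W" for i
    by (induction i) (simp_all add: w_def v' gW)
  have Zw: "Zo (w i) = vec_scale (cas_value r d) (w i)" for i
    by (simp add: w_def Zo_pow Zv pow_scale)
  have Lw: "Lo (w (Suc i)) = vec_scale (lower_coeff r d (Suc i)) (w i)" for i
  proof -
    have "vec_scale ((Q - 1)\<^sup>2) (Lo (w (Suc i))) =
        vec_scale ((Q ^ Suc i - 1) * (cas_value r i - cas_value r d)) (w i)"
      unfolding w_def Lo_Ra_pow[OF v'(2,3)] Zw[unfolded w_def]
      by (simp only: vec.scale_left_diff_distrib[symmetric] vec.scale_scale)
    then have "Lo (w (Suc i)) = vec_scale (inverse ((Q - 1)\<^sup>2) * ((Q ^ Suc i - 1) * (cas_value r i - cas_value r d))) (w i)"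
      by (metis Q_neq(3) power_not_zero left_inverse vec.scale_one vec.scale_scale)
    also have "inverse ((Q - 1)\<^sup>2) * ((Q ^ Suc i - 1) * (cas_value r i - cas_value r d)) = lower_coeff r d (Suc i)"
      by (simp add: lower_coeff_def cas_value_def divide_inverse algebra_simps)
    finally show ?thesis .
  qed
  have w0: "w i = 0 \<longleftrightarrow> d < i" for i
  proof
    show "w i = 0 \<Longrightarrow> d < i"
      using min_d[OF v(1), of i] by (force simp: w_def)
    assume "d < i"
    then obtain m where "i = m + Suc d"
      using less_imp_Suc_add[of d i] by (auto simp: add.commute)
    then have "w i = (Ra ^^ m) 0"
      using v(2) by (simp only: w_def funpow_add o_apply)
    also have "\<dots> = 0"
      by (induction m) (simp_all only: funpow.simps id_apply o_apply mat_vec_zero)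
    finally show "w i = 0" .
  qed
  have Fw: "Fo (r + i) (w i) = w i" for i
    unfolding w_def by (rule Fo_Ra_pow[OF v'(2)])
  have Fw': "Fo j (w i) = (if j = r + i then w i else 0)" for i j
    using Fo_Fo[of j "r + i" "w i"] unfolding Fw by (auto simp: Fw)
  have Rw: "Ra (w i) = w (Suc i)" for i
    by (simp add: w_def)
  have Lw0: "Lo (w 0) = 0"
    using v' by (simp add: w_def)
  have str: "is_string r d w"
    unfolding is_string_def using Fw Lw Rw Lw0 w0 Zw by blast
  \<comment> \<open>\<open>L\<close>, \<open>R\<close> and the level projections send string vectors
    to multiples of string vectors; a nonzero graded subspace of W is W.\<close>
  have "graded (vec.span (range w))"
  proof -
    have sp: "vec.span (range w) \<subseteq> {u. A u \<in> vec.span (range w)}"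
      if "\<And>i. A (w i) \<in> vec.span (range w)" "\<And>a b. A (a + b) = A a + A b"
        "\<And>c a. A (vec_scale c a) = vec_scale c (A a)" for A
    proof (rule vec.span_minimal)
      have "A 0 = 0" using that(3)[of 0 0] by simp
      then show "vec.subspace {u. A u \<in> vec.span (range w)}"
        using that by (auto intro!: vec.subspaceI simp: vec.span_zero vec.span_add vec.span_scale simp del: plus_fun_apply)
    qed (use that in auto)
    have b: "w i \<in> vec.span (range w)" for i
      by (rule vec.span_base) simp
    have "Lo (w i) \<in> vec.span (range w)" for i
      by (cases i) (simp_all add: Lw0 Lw b vec.span_scale vec.span_zero)
    then have "vec.span (range w) \<subseteq> {u. Lo u \<in> vec.span (range w)}"
      by (rule sp) (rule mat_vec_add mat_vec_scale)+
    moreover have "vec.span (range w) \<subseteq> {u. Ra u \<in> vec.span (range w)}"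
      by (rule sp) (simp_all only: Rw b mat_vec_add mat_vec_scale)
    moreover have "Fo j (w i) \<in> vec.span (range w)" for i j
      by (simp add: Fw' b vec.span_zero)
    then have "vec.span (range w) \<subseteq> {u. Fo j u \<in> vec.span (range w)}" for j
      by (rule sp) (rule mat_vec_add mat_vec_scale)+
    moreover have "vec.span (range w) \<subseteq> vecs P"
      using wW gW by (intro vec.span_minimal subspace_vecs) auto
    ultimately show ?thesis
      unfolding graded_def by blast
  qed
  moreover have "vec.span (range w) \<subseteq> W"
    using wW gW by (intro vec.span_minimal) auto
  moreover have "w 0 \<noteq> 0" "w 0 \<in> vec.span (range w)"
    using w0[of 0] vec.span_base[of "w 0" "range w"] by auto
  ultimately have span: "W = vec.span (range w)"
    using min[of "vec.span (range w)"] by auto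
  \<comment> \<open>So far d is only the length of the shortest string; the levels that the string
    occupies show that it is the diameter.\<close>
  have S_eq: "S = {r..r + d}"
  proof (intro equalityI subsetI)
    fix j assume "j \<in> {r..r + d}"
    then obtain i where i: "j = r + i" "i \<le> d"
      using le_Suc_ex by (auto simp: le_iff_add)
    then have "Fo j (w i) \<noteq> 0"
      using w0[of i] by (simp add: Fw)
    then show "j \<in> S"
      using wW Fo_large[of j "w i"] by (auto simp: S not_less[symmetric])
  next
    fix j assume j: "j \<in> S"
    then obtain u where u: "u \<in> W" "Fo j u \<noteq> 0"
      by (auto simp: S)
    show "j \<in> {r..r + d}"
    proof (rule ccontr)
      assume "j \<notin> {r..r + d}"
      then have "Fo j (w i) = 0" for i
        using w0[of i] by (auto simp: Fw')
      moreover have "vec.subspace {u. Fo j u = 0}"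
        by (rule vec.subspaceI) (simp_all add: mat_vec_zero mat_vec_add mat_vec_scale del: plus_fun_apply)
      ultimately have "vec.span (range w) \<subseteq> {u. Fo j u = 0}"
        by (intro vec.span_minimal) auto
      then show False using u span by blast
    qed
  qed
  have "endpoint scale h N W = r" "diameter scale h N W = d"
    by (simp add: endpoint_def r_def S_def) (simp add: diameter_def S_eq flip: S_def)
  moreover have "r + d \<in> S"
    by (simp add: S_eq)
  ultimately show thesis
    using that str span by (simp add: S)
qed

section \<open>Complete reducibility\<close>

text \<open>The Hermitian form with orthonormal basis \<open>P\<close>. It does not see entries
  outside \<open>P\<close>, so it is definite on \<open>vecs P\<close> only.\<close>

definition ip :: "('b set \<Rightarrow> complex) \<Rightarrow> ('b set \<Rightarrow> complex) \<Rightarrow> complex" where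
  "ip v w = (\<Sum>x\<in>P. v x * cnj (w x))"

lemma ip_linear:
  "ip (v + v') w = ip v w + ip v' w" "ip (v - v') w = ip v w - ip v' w"
  "ip (vec_scale c v) w = c * ip v w" "ip 0 w = 0"
  "ip v (w + w') = ip v w + ip v w'" "ip v (vec_scale c w) = cnj c * ip v w" "ip v 0 = 0"
  by (simp_all add: ip_def vec_scale_def algebra_simps sum.distrib sum_subtractf sum_distrib_left)

lemma ip_self_eq_0:
  assumes "v \<in> vecs P" "ip v v = 0"
  shows "v = 0"
proof -
  have "(\<Sum>x\<in>P. (cmod (v x))\<^sup>2) = Re (ip v v)"
    by (simp add: ip_def complex_mult_cnj cmod_power2)
  then have "(\<Sum>x\<in>P. (cmod (v x))\<^sup>2) = 0"
    using assms(2) by simp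
  then have "\<forall>x\<in>P. v x = 0"
    by (subst (asm) sum_nonneg_eq_0_iff) auto
  then show ?thesis
    using assms(1) by (auto simp: vecs_def fun_eq_iff)
qed

lemma ip_mat_vec_adjoint:
  assumes "\<And>x y. B y x = cnj (A x y)"
  shows "ip (mat_vec P A v) w = ip v (mat_vec P B w)"
proof -
  have "ip (mat_vec P A v) w = (\<Sum>x\<in>P. \<Sum>y\<in>P. A x y * v y * cnj (w x))"
    by (simp add: ip_def mat_vec_def sum_distrib_right)
  also have "\<dots> = (\<Sum>y\<in>P. \<Sum>x\<in>P. A x y * v y * cnj (w x))"
    by (rule sum.swap)
  also have "\<dots> = ip v (mat_vec P B w)"
    by (simp add: ip_def mat_vec_def sum_distrib_left assms algebra_simps)
  finally show ?thesis .
qed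

lemma ip_adjoint:
  "ip (Ra v) w = ip v (Lo w)" "ip (Lo v) w = ip v (Ra w)" "ip (Fo i v) w = ip v (Fo i w)"
  by (rule ip_mat_vec_adjoint; simp add: raising_def lowering_def att_F_def)+

lemma orthogonal_span:
  assumes "\<And>b. b \<in> B \<Longrightarrow> ip v b = 0" "u \<in> vec.span B"
  shows "ip v u = 0"
proof -
  have "vec.span B \<subseteq> {u. ip v u = 0}"
    using assms(1) by (intro vec.span_minimal vec.subspaceI) (auto simp: ip_linear simp del: plus_fun_apply)
  then show ?thesis using assms(2) by blast
qed

text \<open>A Gram-Schmidt step: the induction hypothesis is applied to v and to the new generator
  b, and v is then corrected along b' = b - t, which is orthogonal to the earlier
  generators.\<close>

lemma orthogonal_projection:
  assumes "finite B" "B \<subseteq> vecs P"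
  shows "\<exists>u\<in>vec.span B. \<forall>b\<in>B. ip (v - u) b = 0"
  using assms
proof (induction B arbitrary: v rule: finite_induct)
  case empty
  then show ?case by (auto simp: vec.span_zero)
next
  case (insert b B)
  have sub: "vec.span B \<subseteq> vec.span (insert b B)"
    by (rule vec.span_mono) auto
  obtain u where u: "u \<in> vec.span B" "\<forall>c\<in>B. ip (v - u) c = 0"
    using insert by blast
  obtain t where t: "t \<in> vec.span B" "\<forall>c\<in>B. ip (b - t) c = 0"
    using insert by blast
  define b' where "b' = b - t"
  have B_vecs: "vec.span B \<subseteq> vecs P"
    using insert.prems by (intro vec.span_minimal subspace_vecs) auto
  then have b'P: "b' \<in> vecs P"
    using insert.prems t(1) by (auto simp: b'_def intro!: vec.subspace_diff[OF subspace_vecs])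
  define k where "k = ip (v - u) b' / ip b' b'"
  \<comment> \<open>B may be dependent. If b' = 0, division by zero gives k = 0 and both sides
    vanish.\<close>
  have k: "k * ip b' b' = ip (v - u) b'"
    using ip_self_eq_0[OF b'P] ip_linear(7) by (cases "ip b' b' = 0") (auto simp: k_def)
  define u' where "u' = u + vec_scale k b'"
  have b_span: "b \<in> vec.span (insert b B)"
    by (rule vec.span_base) simp
  have "u' \<in> vec.span (insert b B)"
    using u(1) t(1) sub b_span
    by (auto simp: u'_def b'_def intro!: vec.span_add vec.span_scale vec.span_diff)
  moreover have diff: "v - u' = (v - u) - vec_scale k b'"
    by (simp add: u'_def)
  have B: "ip (v - u') c = 0" if "c \<in> B" for c
  proof -
    have "ip (v - u) c = 0" "ip b' c = 0"
      using u(2) t(2) that unfolding b'_def by blast+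
    then show ?thesis
      by (simp only: diff ip_linear(2)[of "v - u"] ip_linear(3) mult_zero_right diff_self)
  qed
  moreover have "ip (v - u') b = 0"
  proof -
    have "ip (v - u') t = 0"
      using B t(1) by (rule orthogonal_span)
    moreover have "ip (v - u') b' = 0"
      by (simp only: diff ip_linear(2)[of "v - u"] ip_linear(3) k diff_self)
    moreover have "b = b' + t"
      by (simp add: b'_def)
    ultimately show ?thesis
      by (metis ip_linear(5) add_0)
  qed
  ultimately show ?case by blast
qed

section \<open>Finite dimension of the function space and existence of irreducible
  submodules\<close>

definition unit_vec :: "'b set \<Rightarrow> 'b set \<Rightarrow> complex" where
  "unit_vec x = (\<lambda>y. if y = x then 1 else 0)"

lemma vec_eq_sum_units: "v = (\<Sum>x\<in>UNIV. vec_scale (v x) (unit_vec x))"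
proof (rule ext)
  fix y
  have "(\<Sum>x\<in>UNIV. vec_scale (v x) (unit_vec x)) y = (\<Sum>x\<in>UNIV. if x = y then v y else 0)"
    unfolding sum_fun_apply by (rule sum.cong) (auto simp: vec_scale_def unit_vec_def)
  then show "v y = (\<Sum>x\<in>UNIV. vec_scale (v x) (unit_vec x)) y"
    by simp
qed

text \<open>The index type is finite, so the space of all functions is finite-dimensional: subspaces
  have finite bases, and \<open>vec.dim\<close> can measure an induction.\<close>

lemma span_units: "vec.span (range unit_vec) = UNIV"
proof -
  have "(\<Sum>x\<in>UNIV. vec_scale (v x) (unit_vec x)) \<in> vec.span (range unit_vec)" for v
    by (intro vec.span_sum vec.span_scale vec.span_base) simp
  then show ?thesis
    using vec_eq_sum_units by (metis UNIV_eq_I)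
qed

lemma exists_finite_spanning:
  fixes U :: "('b set \<Rightarrow> complex) set"
  assumes "vec.subspace U"
  obtains B where "finite B" "B \<subseteq> U" "vec.span B = U" "card B = vec.dim U" "vec.independent B"
proof -
  obtain B where B: "B \<subseteq> U" "vec.independent B" "U \<subseteq> vec.span B" "card B = vec.dim U"
    using vec.basis_exists by blast
  have "finite (range unit_vec)" "B \<subseteq> vec.span (range unit_vec)"
    by (simp_all add: span_units)
  then have "finite B"
    using vec.independent_span_bound B(2) by blast
  then show thesis
    using that B vec.span_subspace[OF B(1,3) assms] by blast
qed

lemma subspace_dim_less:
  fixes U W :: "('b set \<Rightarrow> complex) set"
  assumes "vec.subspace U" "vec.subspace W" "U \<subset> W"
  shows "vec.dim U < vec.dim W"
proof -
  obtain B where B: "finite B" "B \<subseteq> U" "vec.span B = U" "card B = vec.dim U" "vec.independent B"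
    by (rule exists_finite_spanning[OF assms(1)])
  obtain C where C: "finite C" "C \<subseteq> W" "vec.span C = W" "card C = vec.dim W" "vec.independent C"
    by (rule exists_finite_spanning[OF assms(2)])
  obtain w where w: "w \<in> W" "w \<notin> U"
    using assms(3) by blast
  then have "vec.independent (insert w B)"
    using B by (intro vec.independent_insertI) auto
  moreover have "insert w B \<subseteq> vec.span C"
    using w B C assms(3) by auto
  ultimately have "card (insert w B) \<le> card C"
    using vec.independent_span_bound[OF C(1)] by blast
  moreover have "w \<notin> B"
    using w B(2) by blast
  ultimately show ?thesis
    using B C by simp
qed

lemma exists_irreducible:
  assumes "graded U" "U \<noteq> {0}"
  shows "\<exists>W\<subseteq>U. irred W"
  using assms
proof (induction "vec.dim U" arbitrary: U rule: less_induct)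
  case less
  show ?case
  proof (cases "irred U")
    case False
    then obtain U' where U': "graded U'" "U' \<subset> U" "U' \<noteq> {0}"
      using less.prems by (auto simp: irred_iff)
    then have "vec.dim U' < vec.dim U"
      using less.prems by (intro subspace_dim_less) (auto dest: gradedD)
    then show ?thesis
      using less.hyps[of U'] U' by blast
  qed blast
qed

lemma span_invariant:
  assumes "\<And>u. u \<in> B \<Longrightarrow> mat_vec P A u \<in> vec.span B" "u \<in> vec.span B"
  shows "mat_vec P A u \<in> vec.span B"
proof -
  have "vec.subspace {u. mat_vec P A u \<in> vec.span B}"
    by (rule vec.subspaceI)
      (simp_all add: mat_vec_zero mat_vec_add mat_vec_scale vec.span_zero vec.span_add vec.span_scale
        del: plus_fun_apply)
  then have "vec.span B \<subseteq> {u. mat_vec P A u \<in> vec.span B}"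
    using assms(1) by (intro vec.span_minimal) auto
  then show ?thesis using assms(2) by blast
qed

lemma graded_span_Union:
  assumes "\<And>W. W \<in> C \<Longrightarrow> graded W"
  shows "graded (vec.span (\<Union>C))"
proof -
  have "mat_vec P A u \<in> vec.span (\<Union>C)"
    if "\<And>W u. W \<in> C \<Longrightarrow> u \<in> W \<Longrightarrow> mat_vec P A u \<in> W" "u \<in> vec.span (\<Union>C)" for A u
    by (rule span_invariant[OF _ that(2)]) (meson UnionE UnionI that(1) vec.span_base)
  moreover have "vec.span (\<Union>C) \<subseteq> vecs P"
    using assms by (intro vec.span_minimal subspace_vecs) (auto dest: gradedD)
  ultimately show ?thesis
    using assms unfolding graded_def by auto
qed

text \<open>\<open>L\<close> and \<open>R\<close> are adjoint to each other and the level
  projections are self-adjoint.\<close>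

lemma graded_orthogonal:
  assumes "graded U"
  shows "graded {v \<in> vecs P. \<forall>u\<in>U. ip v u = 0}"
proof -
  note U = gradedD[OF assms]
  have "vec.subspace {v \<in> vecs P. \<forall>u\<in>U. ip v u = 0}"
    using subspace_vecs[of P]
    by (intro vec.subspaceI)
      (auto simp: ip_linear vec.subspace_0 vec.subspace_add vec.subspace_scale simp del: plus_fun_apply)
  then show ?thesis
    unfolding graded_def
    using U by (auto simp: ip_adjoint mat_vec_vecs mats_generators)
qed

text \<open>The orthogonal complement of the span is graded. If it were nonzero, it would contain an
  irreducible module, which would also lie in the span and hence be orthogonal to itself.\<close>

lemma span_irreducibles: "vec.span (\<Union>{W. irred W}) = vecs P"
proof -
  define S where "S = vec.span (\<Union>{W. irred W})"
  have S: "graded S"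
    unfolding S_def by (rule graded_span_Union) (simp add: irred_iff)
  define S' where "S' = {v \<in> vecs P. \<forall>u\<in>S. ip v u = 0}"
  have S': "graded S'"
    unfolding S'_def by (rule graded_orthogonal[OF S])
  have "S' = {0}"
  proof (rule ccontr)
    assume "S' \<noteq> {0}"
    then obtain W where W: "W \<subseteq> S'" "irred W"
      using exists_irreducible[OF S'] by blast
    then have "W \<subseteq> S"
      by (auto simp: S_def intro!: vec.span_base)
    have "w = 0" if "w \<in> W" for w
      using that W(1) \<open>W \<subseteq> S\<close> ip_self_eq_0[of w] by (auto simp: S'_def)
    then show False
      using W(2) vec.subspace_0[of W] by (auto simp: irred_iff graded_def)
  qed
  have "v \<in> S" if v: "v \<in> vecs P" for v
  proof -
    obtain B where B: "finite B" "B \<subseteq> S" "vec.span B = S" "card B = vec.dim S" "vec.independent B"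
      by (rule exists_finite_spanning[OF gradedD(2)[OF S]])
    then obtain u where u: "u \<in> S" "\<forall>b\<in>B. ip (v - u) b = 0"
      using orthogonal_projection[of B v] gradedD(1)[OF S] by blast
    have "v - u \<in> S'"
      using u B v gradedD(1)[OF S] orthogonal_span[of B "v - u"]
      by (auto simp: S'_def intro!: vec.subspace_diff[OF subspace_vecs])
    then show ?thesis
      using \<open>S' = {0}\<close> u(1) by simp
  qed
  then show ?thesis
    using gradedD(1)[OF S] by (auto simp: S_def)
qed

text \<open>Reduces an identity of operators to irreducible modules; uniqueness of the idempotents
  and all quantum relations are proved through it.\<close>

lemma mat_vec_eqI:
  assumes "\<And>W w. irred W \<Longrightarrow> w \<in> W \<Longrightarrow> mat_vec P A w = mat_vec P B w" "v \<in> vecs P"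
  shows "mat_vec P A v = mat_vec P B v"
proof -
  have "vec.subspace {u. mat_vec P A u = mat_vec P B u}"
    by (rule vec.subspaceI) (simp_all add: mat_vec_zero mat_vec_add mat_vec_scale del: plus_fun_apply)
  then have "vec.span (\<Union>{W. irred W}) \<subseteq> {u. mat_vec P A u = mat_vec P B u}"
    using assms(1) by (intro vec.span_minimal) auto
  then show ?thesis
    using assms(2) by (auto simp: span_irreducibles)
qed

section \<open>The central idempotents\<close>

abbreviation Psi where "Psi \<equiv> att_Psi scale h N M"
abbreviation mtype where "mtype W \<equiv> (endpoint scale h N W, diameter scale h N W)"

lemma Psi_iff: "l \<in> Psi \<longleftrightarrow> (\<exists>W. irred W \<and> mtype W = l)"
  by (auto simp: att_Psi_def irreducibles_of_type_def)

lemma Psi_bound: "(r, d) \<in> Psi \<Longrightarrow> r + d \<le> N"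
  by (auto simp: Psi_iff elim!: irreducible_string)

lemma finite_Psi: "finite Psi"
proof (rule finite_subset)
  show "Psi \<subseteq> {..N} \<times> {..N}" using Psi_bound by fastforce
qed simp

lemma in_att_V: "irred W \<Longrightarrow> w \<in> W \<Longrightarrow> w \<in> att_V scale h N M (mtype W)"
  unfolding att_V_def by (rule vec.span_base) (auto simp: irreducibles_of_type_def)

lemma string_span_eqI:
  assumes "\<And>i. mat_vec P A (w i) = mat_vec P B (w i)" "u \<in> vec.span (range w)"
  shows "mat_vec P A u = mat_vec P B u"
proof -
  have "vec.subspace {u. mat_vec P A u = mat_vec P B u}"
    by (rule vec.subspaceI) (simp_all add: mat_vec_zero mat_vec_add mat_vec_scale del: plus_fun_apply)
  then have "vec.span (range w) \<subseteq> {u. mat_vec P A u = mat_vec P B u}"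
    using assms(1) by (intro vec.span_minimal) auto
  then show ?thesis using assms(2) by blast
qed

lemma Zo_irred:
  assumes W: "irred W" "u \<in> W"
  shows "Zo u = vec_scale (cas_value (endpoint scale h N W) (diameter scale h N W)) u"
proof -
  let ?c = "cas_value (endpoint scale h N W) (diameter scale h N W)"
  obtain w where w: "is_string (endpoint scale h N W) (diameter scale h N W) w" "W = vec.span (range w)"
    "endpoint scale h N W + diameter scale h N W \<le> N"
    by (rule irreducible_string[OF W(1)])
  have WP: "W \<subseteq> vecs P"
    using W(1) gradedD(1)[of W] by (simp add: irred_iff)
  have "w i \<in> W" for i
    by (subst w(2)) (rule vec.span_base, simp)
  then have "Zo (w i) = mat_vec P (mat_scale ?c (mat_one P)) (w i)" for i
    using w(1) WP by (simp add: is_string_def mat_vec_mat_scale mat_vec_one subset_iff)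
  moreover have "u \<in> vec.span (range w)"
    using W(2) by (simp only: w(2)[symmetric])
  ultimately have "Zo u = mat_vec P (mat_scale ?c (mat_one P)) u"
    by (rule string_span_eqI)
  then show ?thesis
    using W(2) WP by (simp add: mat_vec_mat_scale mat_vec_one subset_iff)
qed

lemma Zo_att_V:
  assumes "v \<in> att_V scale h N M (r, d)"
  shows "Zo v = vec_scale (cas_value r d) v"
proof -
  have "vec.subspace {u. Zo u = vec_scale (cas_value r d) u}"
    by (rule vec.subspaceI)
      (simp_all add: mat_vec_zero mat_vec_add mat_vec_scale vec.scale_right_distrib mult.commute del: plus_fun_apply)
  then have "att_V scale h N M (r, d) \<subseteq> {u. Zo u = vec_scale (cas_value r d) u}"
    unfolding att_V_def using Zo_irred
    by (intro vec.span_minimal) (auto simp: irreducibles_of_type_def)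
  then show ?thesis using assms by blast
qed

lemma two_power_sum_less:
  assumes "2 \<le> (k :: nat)" "b < a" "a < a'"
  shows "k ^ a + k ^ b < k ^ a'"
proof -
  have "k ^ b < k ^ a"
    using assms by (intro power_strict_increasing) auto
  then have "k ^ a + k ^ b < 2 * k ^ a" by simp
  also have "\<dots> \<le> k * k ^ a" using assms by simp
  also have "\<dots> = k ^ Suc a" by simp
  also have "\<dots> \<le> k ^ a'" using assms by (intro power_increasing) auto
  finally show ?thesis .
qed

text \<open>The value is q^a + q^b with a = n-r+1 > b = n-r-d. Since q \<ge> 2, this is less than
  q^(a+1), so a is determined, then b, and with them r and d.\<close>

lemma cas_value_inject:
  assumes "r + d \<le> N" "r' + d' \<le> N" "cas_value r d = cas_value r' d'"
  shows "r = r' \<and> d = d'"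
proof -
  have cas: "cas_value r d = of_nat (CARD('a) ^ (N + M - r + 1) + CARD('a) ^ (N + M - r - d))"
    if "r + d \<le> N" for r d
  proof -
    have "Q ^ (N + M - r + 1) = Q ^ (N + M - r - d) * Q ^ Suc d"
      using that by (simp flip: power_add power_Suc)
    then have "Q * Q ^ (N + M - r) / Q ^ Suc d = Q ^ (N + M - r - d)"
      by (simp add: field_simps)
    then have "cas_value r d = Q ^ (N + M - r + 1) + Q ^ (N + M - r - d)"
      by (simp add: cas_value_def distrib_left)
    then show ?thesis by (simp add: Q_def)
  qed
  define a b a' b' where "a = N + M - r + 1" "b = N + M - r - d" "a' = N + M - r' + 1" "b' = N + M - r' - d'"
  have eq: "CARD('a) ^ a + CARD('a) ^ b = CARD('a) ^ a' + CARD('a) ^ b'"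
    using assms unfolding cas[OF assms(1)] cas[OF assms(2)] of_nat_eq_iff a_b_a'_b'_def by simp
  have "b < a" "b' < a'"
    using assms by (auto simp: a_b_a'_b'_def)
  then have "a = a'"
    using two_power_sum_less[OF q_ge_2, of b a a'] two_power_sum_less[OF q_ge_2, of b' a' a] eq
    by linarith
  moreover have "b = b'"
    using eq \<open>a = a'\<close> q_ge_2 by simp
  ultimately show ?thesis
    using assms by (auto simp: a_b_a'_b'_def)
qed

lemma att_V_vecs: "att_V scale h N M l \<subseteq> vecs P"
  unfolding att_V_def
  by (intro vec.span_minimal subspace_vecs) (auto simp: irreducibles_of_type_def irred_iff dest: gradedD)

lemma exists_projector:
  assumes "finite S" "S \<subseteq> Psi" "l \<in> Psi" "l \<notin> S"
  shows "\<exists>E\<in>mats P. (\<forall>v\<in>att_V scale h N M l. mat_vec P E v = v) \<and>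
    (\<forall>m\<in>S. \<forall>v\<in>att_V scale h N M m. mat_vec P E v = 0)"
  using assms
proof (induction S rule: finite_induct)
  case empty
  then show ?case
    by (intro bexI[of _ "mat_one P"]) (use att_V_vecs in \<open>auto simp: mat_vec_one mats_closed subset_iff\<close>)
next
  case (insert m S)
  have "S \<subseteq> Psi" "l \<notin> S"
    using insert.prems by auto
  then obtain E where E: "E \<in> mats P" "\<forall>v\<in>att_V scale h N M l. mat_vec P E v = v"
    "\<forall>m\<in>S. \<forall>v\<in>att_V scale h N M m. mat_vec P E v = 0"
    using insert.IH insert.prems(2) by blast
  define z where "z = case_prod cas_value"
  have ne: "z l \<noteq> z m"
    using cas_value_inject[of "fst l" "snd l" "fst m" "snd m"] Psi_bound[of "fst l" "snd l"]
      Psi_bound[of "fst m" "snd m"] insert.prems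
    by (auto simp: z_def split_def prod_eq_iff)
  \<comment> \<open>The Lagrange factor for m: the identity on V_l, zero on V_m and a scalar on
    every other V_n, so the earlier conditions on E survive.\<close>
  define A where "A = mat_scale (inverse (z l - z m)) (Cas - mat_scale (z m) (mat_one P))"
  have A: "mat_vec P A v = vec_scale ((z n - z m) / (z l - z m)) v"
    if "v \<in> att_V scale h N M n" for n v
  proof -
    have "v \<in> vecs P"
      using that att_V_vecs by blast
    moreover
    have "Zo v = vec_scale (z n) v"
      using Zo_att_V[of v "fst n" "snd n"] that by (simp add: z_def split_def)
    ultimately have "mat_vec P A v = vec_scale (inverse (z l - z m)) (vec_scale (z n) v - vec_scale (z m) v)"
      by (simp only: A_def mat_vec_mat_scale mat_vec_mat_diff mat_vec_one finite_vector_sets)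
    then show ?thesis
      by (simp only: vec.scale_left_diff_distrib[symmetric] vec.scale_scale divide_inverse mult.commute)
  qed
  have "mat_mult P E A \<in> mats P"
    unfolding A_def by (intro mats_closed mats_Cas E(1))
  moreover have "mat_vec P (mat_mult P E A) v = v" if "v \<in> att_V scale h N M l" for v
  proof -
    have "mat_vec P E v = v"
      using that E(2) by blast
    then show ?thesis
      using ne by (simp add: mat_vec_mult A[OF that] mat_vec_scale)
  qed
  moreover have "mat_vec P (mat_mult P E A) v = 0" if "n \<in> insert m S" "v \<in> att_V scale h N M n" for n v
  proof (cases "n = m")
    case True
    then show ?thesis
      using that(2) by (simp add: mat_vec_mult A mat_vec_zero)
  next
    case False
    then have "mat_vec P E v = 0"
      using that E(3) by blast
    then show ?thesis
      by (simp only: mat_vec_mult A[OF that(2)] mat_vec_scale vec.scale_zero_right)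
  qed
  ultimately show ?case by blast
qed

text \<open>Existence is \<open>exists_projector\<close> with every other type excluded. Two
  candidates agree on each irreducible module, and these span, so the definite description
  denotes.\<close>

lemma att_e:
  assumes l: "l \<in> Psi"
  shows "att_e scale h N M l \<in> mats P"
    and "irred W \<Longrightarrow> w \<in> W \<Longrightarrow> mat_vec P (att_e scale h N M l) w = (if mtype W = l then w else 0)"
proof -
  let ?Pr = "\<lambda>E. E \<in> mats P \<and> (\<forall>v\<in>att_V scale h N M l. mat_vec P E v = v) \<and>
    (\<forall>m\<in>Psi. m \<noteq> l \<longrightarrow> (\<forall>v\<in>att_V scale h N M m. mat_vec P E v = 0))"
  have act: "mat_vec P E w = (if mtype W = l then w else 0)" if "?Pr E" "irred W" "w \<in> W" for E W w
    using that in_att_V[OF that(2,3)] Psi_iff[of "mtype W"] by auto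
  obtain E where E: "?Pr E"
    using exists_projector[of "Psi - {l}" l] finite_Psi l by blast
  have e: "?Pr (att_e scale h N M l)"
    unfolding att_e_def
  proof (rule theI[of ?Pr E, OF E])
    fix E' assume E': "?Pr E'"
    show "E' = E"
    proof (rule mats_eqI[of P])
      fix v assume "v \<in> vecs P"
      then show "mat_vec P E' v = mat_vec P E v"
        by (rule mat_vec_eqI[rotated]) (simp only: act[OF E] act[OF E'])
    qed (use E E' in auto)
  qed
  then show "att_e scale h N M l \<in> mats P" by blast
  show "irred W \<Longrightarrow> w \<in> W \<Longrightarrow> mat_vec P (att_e scale h N M l) w = (if mtype W = l then w else 0)"
    using act[OF e] .
qed

section \<open>Operators that are scalar on each type\<close>

definition central :: "(nat \<times> nat \<Rightarrow> complex) \<Rightarrow> 'b set \<Rightarrow> 'b set \<Rightarrow> complex" where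
  "central g = (\<Sum>l\<in>Psi. mat_scale (g l) (att_e scale h N M l))"

lemma mats_central: "central g \<in> mats P"
  unfolding central_def by (intro mats_sum mats_closed att_e)

lemma central_act:
  assumes "irred W" "w \<in> W"
  shows "mat_vec P (central g) w = vec_scale (g (mtype W)) w"
proof -
  have "mtype W \<in> Psi"
    using assms(1) by (auto simp: Psi_iff)
  have "mat_vec P (central g) w = (\<Sum>l\<in>Psi. if l = mtype W then vec_scale (g (mtype W)) w else 0)"
    unfolding central_def mat_vec_mat_sum
    by (rule sum.cong) (auto simp: mat_vec_mat_scale att_e(2)[OF _ assms])
  also have "\<dots> = vec_scale (g (mtype W)) w"
    using finite_Psi \<open>mtype W \<in> Psi\<close> by simp
  finally show ?thesis .
qed

lemma att_Phi_eq: "att_Phi scale h N M = central (\<lambda>(r, d). Q ^ r)"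
  by (simp add: att_Phi_def central_def Q_def split_def)

lemma att_Omega_eq: "att_Omega scale h N M s = central (\<lambda>(r, d). s ^ d)"
  by (simp add: att_Omega_def central_def split_def)

end

text \<open>With t = \<tau>, e = \<tau>^d and A = q^i, the right side is the quantum integer [d-2i],
  and the left side is the rescaled difference of the lowering coefficients at i + 1 and i.\<close>

lemma quantum_number_identity:
  fixes t e A q :: complex
  assumes "t \<noteq> 0" "q \<noteq> 1" "A \<noteq> 0" "e \<noteq> 0" and q: "q = t\<^sup>2"
  shows "t * e * q * ((q * A - 1) * (1 / (q * A) - 1 / (q * e\<^sup>2)) - (A - 1) * (1 / A - 1 / (q * e\<^sup>2))) / (q - 1)\<^sup>2 =
    inverse (t - inverse t) * (e / A - A / e)"
proof -
  have "q \<noteq> 0" "q - 1 \<noteq> 0" using assms by auto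
  have "(q * A - 1) * (1 / (q * A) - 1 / (q * e\<^sup>2)) - (A - 1) * (1 / A - 1 / (q * e\<^sup>2)) =
      (q - 1) * (1 / A - A / e\<^sup>2) / q"
    using assms(3,4) \<open>q \<noteq> 0\<close> by (simp add: field_simps)
  then have "t * e * q * ((q * A - 1) * (1 / (q * A) - 1 / (q * e\<^sup>2)) - (A - 1) * (1 / A - 1 / (q * e\<^sup>2))) / (q - 1)\<^sup>2 =
      t * e * (1 / A - A / e\<^sup>2) / (q - 1)"
    using \<open>q \<noteq> 0\<close> \<open>q - 1 \<noteq> 0\<close> by (simp add: power2_eq_square)
  also have "e * (1 / A - A / e\<^sup>2) = e / A - A / e"
    using assms(4) by (simp add: right_diff_distrib power2_eq_square)
  then have "t * e * (1 / A - A / e\<^sup>2) / (q - 1) = t / (q - 1) * (e / A - A / e)"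
    by (simp add: mult.assoc)
  also have "t / (q - 1) = inverse (t - inverse t)"
    using assms(1) unfolding q by (simp add: field_simps power2_eq_square)
  finally show ?thesis .
qed

context attenuated_space begin

section \<open>The quantum group relations\<close>

lemma Kinv_in_T: "Kinv \<in> T"
  using mat_inv_K by (auto simp: att_T_def intro!: hull_inc)

lemma irred_closed:
  assumes "irred W" "w \<in> W" "A \<in> T"
  shows "mat_vec P A w \<in> W"
  using assms by (auto simp: irreducible_submodule_of_def submodule_of_def)

lemma irred_vecs: "irred W \<Longrightarrow> w \<in> W \<Longrightarrow> w \<in> vecs P"
  by (auto simp: irreducible_submodule_of_def submodule_of_def)

lemma center_commute:
  assumes "Z \<in> mat_center P T" "A \<in> T"
  shows "mat_vec P Z (mat_vec P A v) = mat_vec P A (mat_vec P Z v)"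
proof -
  have "mat_mult P Z A = mat_mult P A Z"
    using assms unfolding mat_center_def by blast
  then show ?thesis
    by (simp only: mat_vec_mult[symmetric])
qed

lemma Ko_Kinv_string:
  assumes w: "is_string r d w" and i: "i \<le> d" "r + d \<le> N"
  shows "Ko (w i) = vec_scale (Q ^ (N + M) / (Q ^ r * Q ^ i)) (w i)"
    and "mat_vec P Kinv (w i) = vec_scale (Q ^ r * Q ^ i / Q ^ (N + M)) (w i)"
proof -
  let ?c = "Q ^ (N + M) / (Q ^ r * Q ^ i)"
  have Fw: "Fo (r + i) (w i) = w i"
    using w by (simp add: is_string_def)
  then have wP: "w i \<in> vecs P"
    using mat_vec_vecs[OF mats_generators(5)] by metis
  have "Q ^ (N + M) = Q ^ (N + M - (r + i)) * Q ^ (r + i)"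
    using i by (simp flip: power_add)
  then have c: "Q ^ (N + M - (r + i)) = ?c"
    by (simp add: power_add)
  show K: "Ko (w i) = vec_scale ?c (w i)"
    using Ko_Fo[of "r + i" "w i"] by (simp only: Fw c)
  have "w i = vec_scale ?c (mat_vec P Kinv (w i))"
    using Kinv_Ko(1)[OF wP] by (simp only: K mat_vec_scale)
  then have "vec_scale (inverse ?c) (w i) = mat_vec P Kinv (w i)"
    by (metis Q_neq(1) divide_eq_0_iff left_inverse mult_eq_0_iff power_not_zero vec.scale_one vec.scale_scale)
  then show "mat_vec P Kinv (w i) = vec_scale (Q ^ r * Q ^ i / Q ^ (N + M)) (w i)"
    by (simp add: inverse_eq_divide)
qed

text \<open>s and k are the scalars that enter the actions of f and k on modules of this type. On a
  string vector both sides are multiples of that vector, and \<open>quantum_number_identity\<close>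
  compares the coefficients.\<close>

lemma commutator_irred:
  assumes W: "irred W" "u \<in> W" and r: "r = endpoint scale h N W" and d: "d = diameter scale h N W"
    and t: "t\<^sup>2 = Q"
    and s: "s = t / Q ^ (N + M) * (Q ^ r * t ^ d)"
    and k: "k = Q ^ r * t ^ d / Q ^ (N + M)"
  shows "vec_scale s (Lo (Ra u) - Ra (Lo u)) =
    vec_scale (inverse (t - inverse t)) (vec_scale k (Ko u) - vec_scale (inverse k) (mat_vec P Kinv u))"
proof -
  obtain w where w: "is_string r d w" "W = vec.span (range w)" "r + d \<le> N"
    unfolding r d by (rule irreducible_string[OF W(1)])
  let ?L = "lowering P" and ?R = "raising P"
  let ?A = "mat_scale s (mat_mult P ?L ?R - mat_mult P ?R ?L)"
  let ?B = "mat_scale (inverse (t - inverse t)) (mat_scale k Kmat - mat_scale (inverse k) Kinv)"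
  have "t \<noteq> 0" using t Q_neq(1) by auto
  have "mat_vec P ?A (w i) = mat_vec P ?B (w i)" for i
  proof (cases "i \<le> d")
    case True
    have LR: "Lo (Ra (w i)) = vec_scale (lower_coeff r d (Suc i)) (w i)"
      using w(1) by (simp add: is_string_def)
    \<comment> \<open>At i = 0 this reads 0 = 0, since \<open>lower_coeff r d 0\<close>
      vanishes.\<close>
    have RL: "Ra (Lo (w i)) = vec_scale (lower_coeff r d i) (w i)"
      using w(1) by (cases i) (simp_all add: is_string_def mat_vec_zero mat_vec_scale lower_coeff_def)
    have A: "mat_vec P ?A (w i) = vec_scale (s * (lower_coeff r d (Suc i) - lower_coeff r d i)) (w i)"
      by (simp only: mat_vec_mat_scale mat_vec_mat_diff mat_vec_mult LR RL
          vec.scale_left_diff_distrib[symmetric] vec.scale_scale)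
    have B: "mat_vec P ?B (w i) = vec_scale (inverse (t - inverse t) *
        (k * (Q ^ (N + M) / (Q ^ r * Q ^ i)) - inverse k * (Q ^ r * Q ^ i / Q ^ (N + M)))) (w i)"
      by (simp only: mat_vec_mat_scale mat_vec_mat_diff Ko_Kinv_string[OF w(1) True w(3)]
          vec.scale_left_diff_distrib[symmetric] vec.scale_scale)
    have "Q ^ (N + M) = Q ^ (N + M - r) * Q ^ r"
      using w(3) by (simp flip: power_add)
    then have sQ: "s * (Q * Q ^ (N + M - r)) = t * t ^ d * Q"
      by (simp add: s)
    have td: "Q ^ d = (t ^ d)\<^sup>2"
      by (simp add: t[symmetric] power2_eq_square power_mult_distrib)
    have "s * (lower_coeff r d (Suc i) - lower_coeff r d i) =
        s * (Q * Q ^ (N + M - r)) * ((Q * Q ^ i - 1) * (1 / (Q * Q ^ i) - 1 / (Q * (t ^ d)\<^sup>2)) -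
          (Q ^ i - 1) * (1 / Q ^ i - 1 / (Q * (t ^ d)\<^sup>2))) / (Q - 1)\<^sup>2"
      by (simp add: lower_coeff_def td[symmetric] diff_divide_distrib[symmetric] right_diff_distrib mult.assoc)
    also have "\<dots> = inverse (t - inverse t) * (t ^ d / Q ^ i - Q ^ i / t ^ d)"
      unfolding sQ using \<open>t \<noteq> 0\<close> by (intro quantum_number_identity) (simp_all add: t)
    also have "t ^ d / Q ^ i = k * (Q ^ (N + M) / (Q ^ r * Q ^ i))"
      by (simp add: k)
    also have "Q ^ i / t ^ d = inverse k * (Q ^ r * Q ^ i / Q ^ (N + M))"
      by (simp add: k)
    finally show ?thesis
      unfolding A B by (rule arg_cong)
  next
    case False
    then have "w i = 0"
      using w(1) by (simp add: is_string_def)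
    then show ?thesis by (simp only: mat_vec_zero)
  qed
  moreover have "u \<in> vec.span (range w)"
    using W(2) by (simp only: w(2)[symmetric])
  ultimately have "mat_vec P ?A u = mat_vec P ?B u"
    by (rule string_span_eqI)
  then show ?thesis
    by (simp only: mat_vec_mat_scale mat_vec_mat_diff mat_vec_mult)
qed

text \<open>Each relation is phrased with two matrices applied to v, so that v may be taken in an
  irreducible module W, where Phi and Omega are scalars. \<Theta> and its inverse keep vectors in W
  because they lie in \<open>T\<close>; being central they pass \<open>L\<close>, \<open>R\<close>
  and \<open>K\<close>, and so cancel.\<close>

lemma quantum_module:
  fixes \<tau> :: complex and \<Theta> :: "'b set \<Rightarrow> 'b set \<Rightarrow> complex"
  assumes tau: "\<tau>\<^sup>2 = Q" and Th: "\<Theta> \<in> mat_center P T"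
    and ex: "\<exists>\<Theta>'\<in>mat_center P T. mat_mult P \<Theta> \<Theta>' = mat_one P"
  defines "Em \<equiv> mat_mult P \<Theta> (lowering P)"
    and "Fm \<equiv> mat_scale (\<tau> powi (1 - 2 * int (N + M)))
      (mat_mult P (mat_inv P \<Theta>) (mat_mult P (att_Phi scale h N M)
        (mat_mult P (att_Omega scale h N M \<tau>) (raising P))))"
    and "Km \<equiv> mat_scale (Q powi (- int (N + M)))
      (mat_mult P (att_Phi scale h N M) (mat_mult P (att_Omega scale h N M \<tau>) Kmat))"
  shows "\<exists>act. usl2_module \<tau> (vecs P) act \<and> (\<forall>v\<in>vecs P.
    act (usl2_gen_class \<tau> Gen_e) v = mat_vec P Em v \<and>
    act (usl2_gen_class \<tau> Gen_f) v = mat_vec P Fm v \<and>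
    act (usl2_gen_class \<tau> Gen_k) v = mat_vec P Km v)"
proof -
  let ?n = "N + M"
  have tau0: "\<tau> \<noteq> 0" using tau Q_neq(1) by auto
  obtain \<Theta>' where Th': "\<Theta>' \<in> mat_center P T" "mat_mult P \<Theta> \<Theta>' = mat_one P"
    using ex by blast
  have T: "\<Theta> \<in> T" "\<Theta>' \<in> T"
    using Th Th'(1) unfolding mat_center_def by blast+
  have "mat_mult P \<Theta> \<Theta>' = mat_mult P \<Theta>' \<Theta>"
    using Th T(2) unfolding mat_center_def by blast
  then have inv: "mat_mult P \<Theta>' \<Theta> = mat_one P"
    using Th'(2) by (simp only:)
  have mats: "\<Theta> \<in> mats P" "\<Theta>' \<in> mats P"
    using T T_mats by auto
  have inv_eq: "mat_inv P \<Theta> = \<Theta>'"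
    using mats Th'(2) inv by (intro mat_inv_eq) auto
  have cancel: "mat_vec P \<Theta> (mat_vec P \<Theta>' v) = v" "mat_vec P \<Theta>' (mat_vec P \<Theta> v) = v" if "v \<in> vecs P" for v
    using that Th'(2) inv by (simp_all add: mat_vec_one flip: mat_vec_mult)
  note comm = center_commute[OF Th generators_in_T(1)] center_commute[OF Th generators_in_T(2)]
    center_commute[OF Th generators_in_T(3)] center_commute[OF Th'(1) generators_in_T(1)]
    center_commute[OF Th'(1) generators_in_T(2)] center_commute[OF Th'(1) generators_in_T(3)]
  \<comment> \<open>The scalars on type (r, d) of q^-n Phi Omega, which multiplies \<open>K\<close>,
    and of q^(-n+1/2) Phi Omega in f, where q^(-n+1/2) = \<tau> / q^n.\<close>
  define kc where "kc = (\<lambda>(r, d). Q ^ r * \<tau> ^ d / Q ^ ?n)"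
  define fc where "fc = (\<lambda>(r, d). \<tau> / Q ^ ?n * (Q ^ r * \<tau> ^ d))"
  have kc0: "kc l \<noteq> 0" for l
    using tau0 by (auto simp: kc_def split_def)
  \<comment> \<open>An explicit inverse of the action of k: the central factor is inverted type by
    type and \<open>K\<close> is replaced by its inverse.\<close>
  define Km' where "Km' = mat_mult P (central (\<lambda>l. inverse (kc l))) Kinv"
  have powi: "\<tau> powi (1 - 2 * int ?n) = \<tau> / Q ^ ?n" "Q powi (- int ?n) = 1 / Q ^ ?n" "\<tau> powi 2 = Q" "\<tau> powi -2 = inverse Q"
  proof -
    have "\<tau> powi (2 * int ?n) = Q ^ ?n"
      using power_int_of_nat[of \<tau> "2 * ?n"] by (simp only: power_mult tau of_nat_mult of_nat_numeral)
    then show "\<tau> powi (1 - 2 * int ?n) = \<tau> / Q ^ ?n"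
      using tau0 by (simp add: power_int_diff)
    show "\<tau> powi -2 = inverse Q"
      using tau by (simp add: power_int_minus)
    show "Q powi (- int ?n) = 1 / Q ^ ?n"
      by (simp only: power_int_minus power_int_of_nat inverse_eq_divide)
  qed (simp add: tau)
  have closed: "Lo w \<in> W" "Ra w \<in> W" "Ko w \<in> W" "mat_vec P Kinv w \<in> W" "mat_vec P \<Theta> w \<in> W" "mat_vec P \<Theta>' w \<in> W"
    if "irred W" "w \<in> W" for W w
    using that T generators_in_T Kinv_in_T by (auto intro: irred_closed)
  have scale_closed: "vec_scale c w \<in> W" if "irred W" "w \<in> W" for c W w
    using that by (auto simp: irred_iff dest!: gradedD(2) intro: vec.subspace_scale)
  have e: "mat_vec P Em w = mat_vec P \<Theta> (Lo w)" for w
    by (simp add: Em_def mat_vec_mult)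
  have f: "mat_vec P Fm w = vec_scale (fc (mtype W)) (mat_vec P \<Theta>' (Ra w))" if "irred W" "w \<in> W" for W w
    using that unfolding Fm_def powi
    by (simp add: mat_vec_mat_scale mat_vec_mult inv_eq att_Phi_eq att_Omega_eq mat_vec_scale
        central_act[OF that(1)] closed fc_def scale_closed mult_ac)
  have k: "mat_vec P Km w = vec_scale (kc (mtype W)) (Ko w)" if "irred W" "w \<in> W" for W w
    using that unfolding Km_def powi
    by (simp add: mat_vec_mat_scale mat_vec_mult att_Phi_eq att_Omega_eq mat_vec_scale
        central_act[OF that(1)] closed kc_def scale_closed mult_ac)
  have k': "mat_vec P Km' w = vec_scale (inverse (kc (mtype W))) (mat_vec P Kinv w)" if "irred W" "w \<in> W" for W w
    using that by (simp add: Km'_def mat_vec_mult central_act[OF that(1)] closed)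
  have mats': "Em \<in> mats P" "Fm \<in> mats P" "Km \<in> mats P" "Km' \<in> mats P"
    unfolding Em_def Fm_def Km_def Km'_def att_Phi_eq att_Omega_eq inv_eq
    by (intro mats_closed mats_generators mats mats_central)+
  define \<rho> where "\<rho> g = mat_vec P (case g of Gen_e \<Rightarrow> Em | Gen_f \<Rightarrow> Fm | Gen_k \<Rightarrow> Km | Gen_kinv \<Rightarrow> Km')" for g
  interpret linear_generators \<rho>
    by unfold_locales (simp_all only: \<rho>_def mat_vec_add mat_vec_scale)
  have "\<exists>act. usl2_module \<tau> (vecs P) act \<and> (\<forall>g. \<forall>v\<in>vecs P. act (usl2_gen_class \<tau> g) v = \<rho> g v)"
  proof (rule usl2_moduleI)
    show "vec.subspace (vecs P)" by (rule subspace_vecs)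
    show "\<rho> g v \<in> vecs P" for g v
      unfolding \<rho>_def using mats' by (intro mat_vec_vecs) (simp split: usl2_gen.split)
  next
    fix v assume v: "v \<in> vecs P"
    note rho = \<rho>_def usl2_gen.case
    have "mat_vec P (mat_mult P Km Km') v = mat_vec P (mat_one P) v"
    proof (rule mat_vec_eqI[OF _ v])
      fix W w assume W: "irred W" "w \<in> W"
      then show "mat_vec P (mat_mult P Km Km') w = mat_vec P (mat_one P) w"
        using kc0[of "mtype W"] irred_vecs[OF W]
        by (simp add: mat_vec_mult k'[OF W] mat_vec_scale k[OF W(1) closed(4)[OF W]] Kinv_Ko mat_vec_one)
    qed
    then show "\<rho> Gen_k (\<rho> Gen_kinv v) = v"
      using v by (simp only: rho mat_vec_mult mat_vec_one finite_vector_sets)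
    have "mat_vec P (mat_mult P Km' Km) v = mat_vec P (mat_one P) v"
    proof (rule mat_vec_eqI[OF _ v])
      fix W w assume W: "irred W" "w \<in> W"
      then show "mat_vec P (mat_mult P Km' Km) w = mat_vec P (mat_one P) w"
        using kc0[of "mtype W"] irred_vecs[OF W]
        by (simp add: mat_vec_mult k[OF W] mat_vec_scale k'[OF W(1) closed(3)[OF W]] Kinv_Ko mat_vec_one)
    qed
    then show "\<rho> Gen_kinv (\<rho> Gen_k v) = v"
      using v by (simp only: rho mat_vec_mult mat_vec_one finite_vector_sets)
    have "mat_vec P (mat_mult P Km Em) v = mat_vec P (mat_scale Q (mat_mult P Em Km)) v"
    proof (rule mat_vec_eqI[OF _ v])
      fix W w assume W: "irred W" "w \<in> W"
      show "mat_vec P (mat_mult P Km Em) w = mat_vec P (mat_scale Q (mat_mult P Em Km)) w"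
        using W closed
        by (simp only: mat_vec_mat_scale mat_vec_mult e k[OF W] k[OF W(1) closed(5)[OF W(1) closed(1)[OF W]]]
            mat_vec_scale comm(3)[symmetric] Ko_Lo vec.scale_scale mult.commute)
    qed
    then show "\<rho> Gen_k (\<rho> Gen_e v) = vec_scale (\<tau> powi 2) (\<rho> Gen_e (\<rho> Gen_k v))"
      by (simp only: rho mat_vec_mult mat_vec_mat_scale powi)
    have "mat_vec P (mat_mult P Km Fm) v = mat_vec P (mat_scale (inverse Q) (mat_mult P Fm Km)) v"
    proof (rule mat_vec_eqI[OF _ v])
      fix W w assume W: "irred W" "w \<in> W"
      have "mat_vec P (mat_mult P Fm Km) w = vec_scale (fc (mtype W) * (kc (mtype W) * Q)) (mat_vec P \<Theta>' (Ko (Ra w)))"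
        by (simp only: mat_vec_mult k[OF W] mat_vec_scale f[OF W(1) closed(3)[OF W]] Ra_Ko vec.scale_scale mult_ac)
      moreover have "mat_vec P (mat_mult P Km Fm) w = vec_scale (fc (mtype W) * kc (mtype W)) (mat_vec P \<Theta>' (Ko (Ra w)))"
        by (simp only: mat_vec_mult f[OF W] mat_vec_scale k[OF W(1) closed(6)[OF W(1) closed(2)[OF W]]]
            comm(6)[symmetric] vec.scale_scale mult_ac)
      ultimately show "mat_vec P (mat_mult P Km Fm) w = mat_vec P (mat_scale (inverse Q) (mat_mult P Fm Km)) w"
        by (simp add: mat_vec_mat_scale)
    qed
    then show "\<rho> Gen_k (\<rho> Gen_f v) = vec_scale (\<tau> powi -2) (\<rho> Gen_f (\<rho> Gen_k v))"
      by (simp only: rho mat_vec_mult mat_vec_mat_scale powi)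
    have "mat_vec P (mat_mult P Em Fm - mat_mult P Fm Em) v =
        mat_vec P (mat_scale (inverse (\<tau> - inverse \<tau>)) (Km - Km')) v"
    proof (rule mat_vec_eqI[OF _ v])
      fix W w assume W: "irred W" "w \<in> W"
      note P = irred_vecs[OF W(1)]
      \<comment> \<open>The inverse of \<Theta> is moved past \<open>L\<close> to meet \<Theta>; in
        the opposite product \<Theta> is moved past \<open>R\<close>.\<close>
      have "mat_vec P Em (mat_vec P Fm w) = vec_scale (fc (mtype W)) (Lo (Ra w))"
        using W by (simp only: e f[OF W] mat_vec_scale comm(5)[symmetric] cancel(1)[OF P] closed)
      moreover have "mat_vec P Fm (mat_vec P Em w) = vec_scale (fc (mtype W)) (Ra (Lo w))"
        using W by (simp only: e f[OF W(1) closed(5)[OF W(1) closed(1)[OF W]]] comm(1)[symmetric] cancel(2)[OF P] closed)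
      moreover have "vec_scale (fc (mtype W)) (Lo (Ra w) - Ra (Lo w)) =
          vec_scale (inverse (\<tau> - inverse \<tau>)) (vec_scale (kc (mtype W)) (Ko w) - vec_scale (inverse (kc (mtype W))) (mat_vec P Kinv w))"
        by (rule commutator_irred[OF W refl refl tau]) (simp_all add: fc_def kc_def)
      ultimately show "mat_vec P (mat_mult P Em Fm - mat_mult P Fm Em) w =
          mat_vec P (mat_scale (inverse (\<tau> - inverse \<tau>)) (Km - Km')) w"
        by (simp only: mat_vec_mat_diff mat_vec_mat_scale mat_vec_mult k[OF W] k'[OF W]
            vec.scale_right_diff_distrib)
    qed
    then show "\<rho> Gen_e (\<rho> Gen_f v) - \<rho> Gen_f (\<rho> Gen_e v) =
        vec_scale (inverse (\<tau> - inverse \<tau>)) (\<rho> Gen_k v - \<rho> Gen_kinv v)"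
      by (simp only: rho mat_vec_mult mat_vec_mat_scale mat_vec_mat_diff)
  qed
  then show ?thesis
    by (auto simp: \<rho>_def)
qed

end

theorem theorem8p2:
  fixes scale :: "'a::{field,finite} \<Rightarrow> 'b::ab_group_add \<Rightarrow> 'b"
    and h :: "'b set"
    and N M :: nat
    and \<tau> :: complex
    and \<Theta> :: "'b set \<Rightarrow> 'b set \<Rightarrow> complex"
  assumes "vector_space scale"
    and "N > 0" and "M > 0"
    and "vector_space.dim scale UNIV = N + M"
    and "module.subspace scale h"
    and "vector_space.dim scale h = M"
    and "\<tau> ^ 2 = of_nat CARD('a)"
    and "\<Theta> \<in> mat_center (att_poset scale h) (att_T scale h N M)"
    and "\<exists>\<Theta>' \<in> mat_center (att_poset scale h) (att_T scale h N M).
           mat_mult (att_poset scale h) \<Theta> \<Theta>' = mat_one (att_poset scale h)"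
  shows "\<exists>act. usl2_module \<tau> (vecs (att_poset scale h)) act \<and>
    (\<forall>v \<in> vecs (att_poset scale h).
      act (usl2_gen_class \<tau> Gen_e) v =
        mat_vec (att_poset scale h)
          (mat_mult (att_poset scale h) \<Theta> (lowering (att_poset scale h))) v \<and>
      act (usl2_gen_class \<tau> Gen_f) v =
        mat_vec (att_poset scale h)
          (mat_scale (\<tau> powi (1 - 2 * int (N + M)))
            (mat_mult (att_poset scale h) (mat_inv (att_poset scale h) \<Theta>)
              (mat_mult (att_poset scale h) (att_Phi scale h N M)
                (mat_mult (att_poset scale h) (att_Omega scale h N M \<tau>)
                  (raising (att_poset scale h)))))) v \<and>
      act (usl2_gen_class \<tau> Gen_k) v =
        mat_vec (att_poset scale h)
          (mat_scale (of_nat CARD('a) powi (- int (N + M)))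
            (mat_mult (att_poset scale h) (att_Phi scale h N M)
              (mat_mult (att_poset scale h) (att_Omega scale h N M \<tau>)
                (att_K scale h N M)))) v)"
proof -
  interpret vector_space scale by (rule assms(1))
  interpret attenuated_space scale h N M
    using assms(2-6) by unfold_locales
  show ?thesis
    using quantum_module[of \<tau> \<Theta>] assms(7-9) by (simp only: Q_def)
qed

end
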